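(* Let $J_{6,3}(X)$ denote the number of solutions $(x_1,\ldots,x_{12})\in\mathbb{N}^{12}$ (with $\mathbb{N}=\{1,2,3,\ldots\}$) of the simultaneous equations \[x_1^j+\cdots+x_6^j=x_7^j+\cdots+x_{12}^j\qquad (j=1,2,3)\] with $x_1,\ldots,x_{12}\le X$. Then for every fixed $\varepsilon>0$ there is a constant $C(\varepsilon)$ such that \[J_{6,3}(X)\le C(\varepsilon)\,X^{6+\varepsilon}\qquad\text{for all real } X\ge 1.\] *)

theory Defs
  imports Complex_Main "HOL-Library.FuncSet"
begin

text \<open>Tuples indexed by \<open>{1..2 * s}\<close> are extensional functions on that index set, so that
  distinct functions correspond to distinct tuples and the set below may be counted by \<open>card\<close>.\<close>

definition vinogradov_solutions :: "nat \<Rightarrow> nat \<Rightarrow> real \<Rightarrow> (nat \<Rightarrow> nat) set" where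
  "vinogradov_solutions s k X =
    {x \<in> {1..2 * s} \<rightarrow>\<^sub>E {n. 1 \<le> n \<and> real n \<le> X}.
      \<forall>j\<in>{1..k}. (\<Sum>i = 1..s. x i ^ j) = (\<Sum>i = s + 1..2 * s. x i ^ j)}"

definition vinogradov_J :: "nat \<Rightarrow> nat \<Rightarrow> real \<Rightarrow> nat" where
  "vinogradov_J s k X = card (vinogradov_solutions s k X)"

lemma finite_vinogradov_solutions: "finite (vinogradov_solutions s k X)"
proof -
  have "{n::nat. 1 \<le> n \<and> real n \<le> X} \<subseteq> {..nat \<lfloor>X\<rfloor>}"
    by (auto simp: le_nat_floor)
  then have "finite {n::nat. 1 \<le> n \<and> real n \<le> X}"
    by (rule finite_subset) simp
  then have "finite ({1..2 * s} \<rightarrow>\<^sub>E {n::nat. 1 \<le> n \<and> real n \<le> X})"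
    by (intro finite_PiE) auto
  then show ?thesis
    unfolding vinogradov_solutions_def by simp
qed

end

theory Submission
  imports Defs "HOL-Analysis.Convex" "HOL-Computational_Algebra.Primes"
begin

text \<open>
  This is Heath-Brown's simplified form of Wooley's efficient congruencing. Let \<open>I\<^sub>m(a, b)\<close> be the
  largest mean value of \<open>|f\<^sub>\<xi>|\<^sup>2\<^sup>m |f\<^sub>\<eta>|\<^sup>1\<^sup>2\<^sup>-\<^sup>2\<^sup>m\<close>, where \<open>f\<^sub>\<xi>\<close> and \<open>f\<^sub>\<eta>\<close> are the exponential sums over the
  classes of \<open>\<xi>\<close> modulo \<open>p\<^sup>a\<close> and of \<open>\<eta>\<close> modulo \<open>p\<^sup>b\<close> with \<open>\<xi> \<noteq> \<eta>\<close> modulo \<open>p\<close>. The congruences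
  between the first variables that the equations force after translating by \<open>\<eta>\<close> allow the modulus
  \<open>p\<^sup>a\<close> to be raised, to \<open>p\<^sup>3\<^sup>b\<close> if \<open>m = 1\<close> and to \<open>p\<^sup>2\<^sup>b\<^sup>-\<^sup>a\<close> if \<open>m = 2\<close>. With Hoelder's inequality this bounds
  \<open>I\<^sub>2(a, b)\<close> by \<open>I\<^sub>2(b, 2b - a)\<close>, \<open>I\<^sub>2(b, 3b)\<close> and \<open>J(2X / p\<^sup>b)\<close>. Each iteration gains a power of \<open>p\<close> over
  the trivial bound, so after enough of them \<open>I\<^sub>2(1, 1)\<close> beats any fixed power of \<open>p\<close>.

  Heath-Brown takes \<open>p\<close> to be a small power of \<open>X\<close>. Here \<open>p\<close> is instead a large constant depending
  on \<open>\<epsilon>\<close>, and \<open>J(X) \<le> C X\<^sup>6\<^sup>+\<^sup>\<epsilon>\<close> is proved by strong induction on \<open>X\<close>; this needs no information on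
  the distribution of primes. Mean values are averages over the points \<open>\<alpha> / N\<close> with
  \<open>\<alpha> \<in> {0..<N}\<^sup>3\<close> rather than integrals over the torus, with \<open>N\<close> so large that the equations modulo \<open>N\<close>
  are equations between integers.
\<close>

section \<open>Counting solutions by exponential sums\<close>

definition power_sums_agree :: "(nat \<Rightarrow> int) \<Rightarrow> bool" where
  "power_sums_agree x \<longleftrightarrow> (\<forall>j\<in>{1..3}. (\<Sum>i=1..6. x i ^ j) = (\<Sum>i=7..12. x i ^ j))"

definition solutions :: "(nat \<Rightarrow> int set) \<Rightarrow> (nat \<Rightarrow> int) set" where
  "solutions A = {x \<in> Pi\<^sub>E {1..12} A. power_sums_agree x}"

definition freqs :: "nat \<Rightarrow> (nat \<Rightarrow> nat) set" where
  "freqs N = Pi\<^sub>E {1..3} (\<lambda>_. {..<N})"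

text \<open>Polymorphic in the value field: orthogonality is a statement about complex averages,
  Hoelder's inequality one about real averages.\<close>

definition mean :: "nat \<Rightarrow> ((nat \<Rightarrow> nat) \<Rightarrow> 'a :: real_field) \<Rightarrow> 'a" where
  "mean N g = (\<Sum>\<alpha>\<in>freqs N. g \<alpha>) / of_nat (N ^ 3)"

definition weyl_sum :: "nat \<Rightarrow> int set \<Rightarrow> (nat \<Rightarrow> nat) \<Rightarrow> complex" where
  "weyl_sum N A \<alpha> = (\<Sum>n\<in>A. cis (2 * pi * (\<Sum>j=1..3. real (\<alpha> j) * of_int (n ^ j)) / N))"

lemma finite_freqs [simp]: "finite (freqs N)"
  by (auto simp: freqs_def intro: finite_PiE)

lemma cis_sum: "finite S \<Longrightarrow> cis (\<Sum>j\<in>S. f j) = (\<Prod>j\<in>S. cis (f j))"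
  by (induction S rule: finite_induct) (auto simp: cis_mult [symmetric])

lemma sum_cis_period:
  assumes "N > 0"
  shows "(\<Sum>a<N. cis (2 * pi * (real a * of_int m) / N)) = (if int N dvd m then of_nat N else 0)"
proof (cases "int N dvd m")
  case True
  then obtain k where k: "m = int N * k" by (elim dvdE)
  have "cis (2 * pi * (real a * of_int m) / N) = 1" for a
  proof -
    have "2 * pi * (real a * of_int m) / N = 2 * pi * of_int (int a * k)"
      using assms by (simp add: k)
    then show ?thesis by (metis cis_multiple_2pi Ints_of_int)
  qed
  with True show ?thesis by simp
next
  case False
  define w where "w = cis (2 * pi * of_int m / N)"
  have w1: "w \<noteq> 1"
  proof
    assume "w = 1"
    then obtain k :: int where "2 * pi * of_int m / N = 2 * pi * of_int k"
      by (auto simp: w_def complex_eq_iff cos_one_2pi_int)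
    then have "real_of_int m = of_int (int N * k)"
      using assms by (simp add: field_simps)
    then have "m = int N * k" by (metis of_int_eq_iff)
    with False show False by simp
  qed
  have "(\<Sum>a<N. cis (2 * pi * (real a * of_int m) / N)) = (\<Sum>a<N. w ^ a)"
    by (simp add: w_def DeMoivre mult_ac)
  also have "\<dots> = (w ^ N - 1) / (w - 1)"
    using w1 by (subst geometric_sum) auto
  also have "w ^ N = cis (2 * pi * of_int m)"
    using assms by (simp add: w_def DeMoivre)
  also have "\<dots> = 1" by simp
  finally show ?thesis using False by simp
qed

text \<open>The sum over the cube of frequencies factors into three complete sums of
  \<open>N\<close>-th roots of unity, each of which is \<open>N\<close> or 0.\<close>

lemma mean_cis:
  assumes "N > 0"
  shows "mean N (\<lambda>\<alpha>. cis (2 * pi * (\<Sum>j=1..3. real (\<alpha> j) * of_int (m j)) / N)) =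
    (if \<forall>j\<in>{1..3}. int N dvd m j then 1 else 0)"
proof -
  have "(\<Sum>\<alpha>\<in>freqs N. cis (2 * pi * (\<Sum>j=1..3. real (\<alpha> j) * of_int (m j)) / N))
    = (\<Sum>\<alpha>\<in>freqs N. \<Prod>j\<in>{1..3}. cis (2 * pi * (real (\<alpha> j) * of_int (m j)) / N))"
  proof (intro sum.cong refl)
    fix \<alpha> :: "nat \<Rightarrow> nat"
    show "cis (2 * pi * (\<Sum>j=1..3. real (\<alpha> j) * of_int (m j)) / N) =
        (\<Prod>j\<in>{1..3}. cis (2 * pi * (real (\<alpha> j) * of_int (m j)) / N))"
      by (simp add: cis_sum [symmetric] sum_distrib_left sum_divide_distrib)
  qed
  also have "\<dots> = (\<Prod>j\<in>{1..3}. \<Sum>a<N. cis (2 * pi * (real a * of_int (m j)) / N))"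
    unfolding freqs_def by (subst prod_sum_PiE) auto
  also have "\<dots> = (\<Prod>j\<in>{1..3::nat}. if int N dvd m j then of_nat N else 0)"
    using assms by (simp add: sum_cis_period)
  also have "\<dots> = (if \<forall>j\<in>{1..3}. int N dvd m j then of_nat (N ^ 3) else 0)"
    by (auto simp: prod_zero_iff)
  finally show ?thesis using assms by (simp add: mean_def)
qed

text \<open>The difference of two sums of six \<open>j\<close>-th powers, \<open>j \<le> 3\<close>, of elements of \<open>{1..X}\<close> is
  smaller than this modulus in absolute value, so it vanishes once it is divisible by it.\<close>

definition modulus :: "nat \<Rightarrow> nat" where
  "modulus X = 6 * X ^ 3 + 1"

lemma modulus_pos [simp]: "modulus X > 0"
  by (simp add: modulus_def)

lemma sum_1_12: "(\<Sum>i\<in>{1..12::nat}. f i) = (\<Sum>i=1..6. f i) + (\<Sum>i=7..12. f i :: 'a :: comm_monoid_add)"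
proof -
  have "{1..12::nat} = {1..6} \<union> {7..12}" by auto
  then show ?thesis by (simp add: sum.union_disjoint)
qed

lemma prod_1_12: "(\<Prod>i\<in>{1..12::nat}. f i) = (\<Prod>i=1..6. f i) * (\<Prod>i=7..12. f i :: 'a :: comm_monoid_mult)"
proof -
  have "{1..12::nat} = {1..6} \<union> {7..12}" by auto
  then show ?thesis by (simp add: prod.union_disjoint)
qed

lemma power_sums_agree_iff_dvd:
  assumes x: "\<And>i. i \<in> {1..12} \<Longrightarrow> x i \<in> {1..int X}"
  shows "power_sums_agree x \<longleftrightarrow>
    (\<forall>j\<in>{1..3}. int (modulus X) dvd (\<Sum>i=1..6. x i ^ j) - (\<Sum>i=7..12. x i ^ j))"
proof -
  have "(int (modulus X) dvd (\<Sum>i=1..6. x i ^ j) - (\<Sum>i=7..12. x i ^ j)) \<longleftrightarrow>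
      (\<Sum>i=1..6. x i ^ j) = (\<Sum>i=7..12. x i ^ j)" if j: "j \<in> {1..3}" for j
  proof -
    have b: "0 \<le> x i ^ j \<and> x i ^ j \<le> int X ^ 3" if "i \<in> {1..12}" for i
    proof -
      have xi: "1 \<le> x i" "x i \<le> int X" using x[OF that] by auto
      then have "x i ^ j \<le> int X ^ j" by (intro power_mono) auto
      also have "\<dots> \<le> int X ^ 3" using xi j by (intro power_increasing) auto
      finally show ?thesis using xi by simp
    qed
    have b1: "(\<Sum>i=1..6. x i ^ j) \<le> of_nat (card {1..6::nat}) * int X ^ 3"
      by (intro sum_bounded_above) (use b in auto)
    have b2: "(\<Sum>i=7..12. x i ^ j) \<le> of_nat (card {7..12::nat}) * int X ^ 3"
      by (intro sum_bounded_above) (use b in auto)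
    have b3: "0 \<le> (\<Sum>i=1..6. x i ^ j)" "0 \<le> (\<Sum>i=7..12. x i ^ j)"
      using b by (auto intro!: sum_nonneg)
    have "\<bar>(\<Sum>i=1..6. x i ^ j) - (\<Sum>i=7..12. x i ^ j)\<bar> < int (modulus X)"
      using b1 b2 b3 by (simp add: modulus_def)
    moreover have "d = 0" if "int (modulus X) dvd d" "\<bar>d\<bar> < int (modulus X)" for d
      using that dvd_imp_le_int[of d "int (modulus X)"] by linarith
    ultimately show ?thesis by (metis diff_self dvd_0_right right_minus_eq)
  qed
  then show ?thesis unfolding power_sums_agree_def by blast
qed

text \<open>The sign with which a variable enters the phase. Conjugation negates the phase, so with
  this sign all twelve factors expand at once by \<open>prod_sum_PiE\<close>.\<close>

definition side_sign :: "nat \<Rightarrow> int" where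
  "side_sign i = (if i \<le> 6 then 1 else -1)"

text \<open>Orthogonality: expanding the product gives one character per tuple, and its average
  detects whether the three differences of power sums vanish modulo
  \<open>modulus X\<close>.\<close>

lemma of_nat_card_solutions:
  assumes A: "\<And>i. i \<in> {1..12} \<Longrightarrow> A i \<subseteq> {1..int X}"
  shows "of_nat (card (solutions A)) = mean (modulus X) (\<lambda>\<alpha>.
    (\<Prod>i=1..6. weyl_sum (modulus X) (A i) \<alpha>) * (\<Prod>i=7..12. cnj (weyl_sum (modulus X) (A i) \<alpha>)))"
proof -
  define N where "N = modulus X"
  have fin: "finite (A i)" if "i \<in> {1..12}" for i
    using A[OF that] by (rule finite_subset) simp
  have finP: "finite (Pi\<^sub>E {1..12} A)" using fin by (intro finite_PiE) auto
  define D where "D = (\<lambda>(x :: nat \<Rightarrow> int) j. (\<Sum>i=1..6. x i ^ j) - (\<Sum>i=7..12. x i ^ j :: int))"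
  define ph where "ph = (\<lambda>\<alpha> n. 2 * pi * (\<Sum>j=1..3. real (\<alpha> j) * of_int (n ^ j)) / N)"
  have expand: "(\<Prod>i=1..6. weyl_sum N (A i) \<alpha>) * (\<Prod>i=7..12. cnj (weyl_sum N (A i) \<alpha>)) =
     (\<Sum>x\<in>Pi\<^sub>E {1..12} A. cis (2 * pi * (\<Sum>j=1..3. real (\<alpha> j) * of_int (D x j)) / N))" for \<alpha>
  proof -
    have "(\<Prod>i=1..6. weyl_sum N (A i) \<alpha>) * (\<Prod>i=7..12. cnj (weyl_sum N (A i) \<alpha>))
      = (\<Prod>i\<in>{1..12}. \<Sum>n\<in>A i. cis (of_int (side_sign i) * ph \<alpha> n))"
      unfolding prod_1_12
      by (intro arg_cong2[where f="(*)"] prod.cong refl)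
         (auto simp: weyl_sum_def side_sign_def ph_def cis_cnj)
    also have "\<dots> = (\<Sum>x\<in>Pi\<^sub>E {1..12} A. \<Prod>i\<in>{1..12}. cis (of_int (side_sign i) * ph \<alpha> (x i)))"
      by (subst prod_sum_PiE) (use fin in auto)
    also have "\<dots> = (\<Sum>x\<in>Pi\<^sub>E {1..12} A. cis (2 * pi * (\<Sum>j=1..3. real (\<alpha> j) * of_int (D x j)) / N))"
    proof (intro sum.cong refl)
      fix x
      have "(\<Sum>i\<in>{1..12}. of_int (side_sign i) * ph \<alpha> (x i)) =
          (\<Sum>i=1..6. ph \<alpha> (x i)) - (\<Sum>i=7..12. ph \<alpha> (x i))"
        unfolding sum_1_12 by (simp add: side_sign_def sum_negf cong: sum.cong_simp)
      also have "\<dots> = 2 * pi * (\<Sum>j=1..3. real (\<alpha> j) * of_int (D x j)) / N"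
        unfolding ph_def D_def sum.swap[of _ "{1..3}" "{1..6}"] sum.swap[of _ "{1..3}" "{7..12}"]
            sum_distrib_left sum_divide_distrib
        by (simp add: sum_distrib_left sum_divide_distrib right_diff_distrib
            diff_divide_distrib sum_subtractf del: One_nat_def)
      finally show "(\<Prod>i\<in>{1..12}. cis (of_int (side_sign i) * ph \<alpha> (x i))) =
          cis (2 * pi * (\<Sum>j=1..3. real (\<alpha> j) * of_int (D x j)) / N)"
        by (metis cis_sum finite_atLeastAtMost)
    qed
    finally show ?thesis .
  qed
  have "mean N (\<lambda>\<alpha>. (\<Prod>i=1..6. weyl_sum N (A i) \<alpha>) * (\<Prod>i=7..12. cnj (weyl_sum N (A i) \<alpha>))) =
     (\<Sum>x\<in>Pi\<^sub>E {1..12} A. mean N (\<lambda>\<alpha>. cis (2 * pi * (\<Sum>j=1..3. real (\<alpha> j) * of_int (D x j)) / N)))"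
    unfolding mean_def expand sum.swap[of _ _ "freqs N"] sum_divide_distrib [symmetric] ..
  also have "\<dots> = (\<Sum>x\<in>Pi\<^sub>E {1..12} A. if power_sums_agree x then 1 else 0)"
  proof (intro sum.cong refl)
    fix x assume x: "x \<in> Pi\<^sub>E {1..12} A"
    have "x i \<in> {1..int X}" if "i \<in> {1..12}" for i using x A[OF that] that by (meson PiE_mem subsetD)
    then have v: "power_sums_agree x \<longleftrightarrow> (\<forall>j\<in>{1..3}. int N dvd D x j)"
      using power_sums_agree_iff_dvd[of x X] by (simp add: N_def D_def)
    show "mean N (\<lambda>\<alpha>. cis (2 * pi * (\<Sum>j=1..3. real (\<alpha> j) * of_int (D x j)) / N)) =
       (if power_sums_agree x then 1 else 0)"
      unfolding v by (rule mean_cis) (simp add: N_def)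
  qed
  also have "\<dots> = of_nat (card (solutions A))"
    using finP by (simp add: solutions_def sum.If_cases Int_def)
  finally show ?thesis by (simp add: N_def)
qed

lemma mean_mono:
  fixes f g :: "(nat \<Rightarrow> nat) \<Rightarrow> real"
  assumes "\<And>\<alpha>. f \<alpha> \<le> g \<alpha>"
  shows "mean N f \<le> mean N g"
  unfolding mean_def using assms by (intro divide_right_mono sum_mono) auto

lemma mean_nonneg:
  fixes f :: "(nat \<Rightarrow> nat) \<Rightarrow> real"
  assumes "\<And>\<alpha>. 0 \<le> f \<alpha>"
  shows "0 \<le> mean N f"
  unfolding mean_def using assms by (intro divide_nonneg_nonneg sum_nonneg) auto

lemma mean_add: "mean N (\<lambda>\<alpha>. f \<alpha> + g \<alpha>) = mean N f + mean N g"
  by (simp add: mean_def sum.distrib add_divide_distrib)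

lemma mean_cmult: "mean N (\<lambda>\<alpha>. c * f \<alpha>) = c * mean N f"
  by (simp add: mean_def sum_distrib_left)

lemma mean_divide: "mean N (\<lambda>\<alpha>. f \<alpha> / c) = mean N f / c"
  by (simp add: mean_def sum_divide_distrib mult.commute)

lemma mean_sum: "mean N (\<lambda>\<alpha>. \<Sum>i\<in>I. f i \<alpha>) = (\<Sum>i\<in>I. mean N (f i))"
  unfolding mean_def sum.swap[of _ I "freqs N"] sum_divide_distrib ..

text \<open>The triangle inequality for the mean. It also covers families whose two sides differ,
  where conjugate factors do not pair up.\<close>

lemma card_solutions_le:
  assumes A: "\<And>i. i \<in> {1..12} \<Longrightarrow> A i \<subseteq> {1..int X}"
  shows "card (solutions A) \<le> mean (modulus X) (\<lambda>\<alpha>. \<Prod>i\<in>{1..12}. cmod (weyl_sum (modulus X) (A i) \<alpha>))"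
proof -
  have "real (card (solutions A)) = cmod (of_nat (card (solutions A)))" by simp
  also have "\<dots> = cmod (mean (modulus X) (\<lambda>\<alpha>.
    (\<Prod>i=1..6. weyl_sum (modulus X) (A i) \<alpha>) * (\<Prod>i=7..12. cnj (weyl_sum (modulus X) (A i) \<alpha>))))"
    by (simp only: of_nat_card_solutions[OF A])
  also have "\<dots> \<le> mean (modulus X) (\<lambda>\<alpha>. \<Prod>i\<in>{1..12}. cmod (weyl_sum (modulus X) (A i) \<alpha>))"
    unfolding mean_def norm_divide norm_of_nat
    by (intro divide_right_mono order.trans[OF norm_sum])
       (simp_all add: norm_mult prod_norm [symmetric] prod_1_12 del: One_nat_def)
  finally show ?thesis .
qed

text \<open>When index \<open>i + 6\<close> carries the same set as \<open>i\<close>, every factor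
  meets its own conjugate, so the integrand is already real and nonnegative. The equality lets a
  mean value be read as a count again.\<close>

lemma card_solutions_eq:
  assumes A: "\<And>i. i \<in> {1..12} \<Longrightarrow> A i \<subseteq> {1..int X}"
    and sym: "\<And>i. i \<in> {1..6} \<Longrightarrow> A (i + 6) = A i"
  shows "card (solutions A) = mean (modulus X) (\<lambda>\<alpha>. \<Prod>i\<in>{1..12}. cmod (weyl_sum (modulus X) (A i) \<alpha>))"
proof -
  have p: "(\<Prod>i=7..12. f (A i)) = (\<Prod>i=1..6. f (A i))" for f :: "int set \<Rightarrow> 'b :: comm_monoid_mult"
    using sym prod.shift_bounds_cl_nat_ivl[of "\<lambda>i. f (A i)" 1 6 6] by simp
  have "complex_of_real (real (card (solutions A))) = of_nat (card (solutions A))" by simp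
  also have "\<dots> = mean (modulus X) (\<lambda>\<alpha>.
    (\<Prod>i=1..6. weyl_sum (modulus X) (A i) \<alpha>) * (\<Prod>i=7..12. cnj (weyl_sum (modulus X) (A i) \<alpha>)))"
    by (rule of_nat_card_solutions[OF A])
  also have "\<dots> = complex_of_real
     (mean (modulus X) (\<lambda>\<alpha>. \<Prod>i\<in>{1..12}. cmod (weyl_sum (modulus X) (A i) \<alpha>)))"
    unfolding mean_def of_real_divide of_real_sum of_real_of_nat_eq
  proof (intro arg_cong2[where f="(/)"] sum.cong refl)
    fix \<alpha>
    let ?w = "\<lambda>A. weyl_sum (modulus X) A \<alpha>"
    have "(\<Prod>i=1..6. ?w (A i)) * (\<Prod>i=7..12. cnj (?w (A i))) = (\<Prod>i=1..6. ?w (A i)) * cnj (\<Prod>i=1..6. ?w (A i))"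
      by (simp only: p[of "\<lambda>B. cnj (?w B)"] cnj_prod)
    also have "\<dots> = complex_of_real ((\<Prod>i=1..6. cmod (?w (A i))) ^ 2)"
      by (simp only: complex_norm_square [symmetric] prod_norm of_real_power)
    also have "(\<Prod>i=1..6. cmod (?w (A i))) ^ 2 = (\<Prod>i\<in>{1..12}. cmod (?w (A i)))"
      by (simp only: prod_1_12 p[of "\<lambda>B. cmod (?w B)"] power2_eq_square)
    finally show "(\<Prod>i=1..6. ?w (A i)) * (\<Prod>i=7..12. cnj (?w (A i))) =
      complex_of_real (\<Prod>i\<in>{1..12}. cmod (?w (A i)))" .
  qed
  finally show ?thesis by (simp only: of_real_eq_iff)
qed

section \<open>Mixed mean values\<close>

text \<open>Both means are normalised to 1 and Young's inequality is applied at each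
  frequency.\<close>

lemma mean_holder:
  fixes f g :: "(nat \<Rightarrow> nat) \<Rightarrow> real"
  assumes f: "\<And>\<alpha>. 0 \<le> f \<alpha>" and g: "\<And>\<alpha>. 0 \<le> g \<alpha>"
    and uv: "0 < u" "0 < v" "u + v = 1" and N: "N > 0"
  shows "mean N (\<lambda>\<alpha>. f \<alpha> powr u * g \<alpha> powr v) \<le> mean N f powr u * mean N g powr v"
proof -
  \<comment> \<open>Normalising divides by the means. If one of them is zero, its nonnegative
    function vanishes at every frequency, and so does the product.\<close>
  have vanish: "\<forall>\<alpha>\<in>freqs N. h \<alpha> = 0" if "mean N h = 0" "\<And>\<alpha>. 0 \<le> h \<alpha>" for h :: "_ \<Rightarrow> real"
    using that N by (simp add: mean_def sum_nonneg_eq_0_iff)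
  show ?thesis
  proof (cases "mean N f = 0 \<or> mean N g = 0")
    case True
    then have "\<forall>\<alpha>\<in>freqs N. f \<alpha> powr u * g \<alpha> powr v = 0"
      using vanish[of f] vanish[of g] f g by auto
    then have "mean N (\<lambda>\<alpha>. f \<alpha> powr u * g \<alpha> powr v) = 0"
      unfolding mean_def by (metis (no_types, lifting) div_0 sum.neutral)
    then show ?thesis by simp
  next
    case False
    define F where "F = mean N f"
    define G where "G = mean N g"
    have FG: "F > 0" "G > 0"
      using False mean_nonneg[of f N] mean_nonneg[of g N] f g by (auto simp: F_def G_def less_le)
    have young: "f \<alpha> powr u * g \<alpha> powr v \<le> F powr u * G powr v * (u * (f \<alpha> / F) + v * (g \<alpha> / G))" for \<alpha>
    proof (cases "f \<alpha> = 0 \<or> g \<alpha> = 0")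
      case True
      have "0 \<le> F powr u * G powr v * (u * (f \<alpha> / F) + v * (g \<alpha> / G))"
        using f g FG uv by (intro mult_nonneg_nonneg add_nonneg_nonneg) auto
      with True show ?thesis by auto
    next
      case False
      then have pos: "f \<alpha> > 0" "g \<alpha> > 0" using f[of \<alpha>] g[of \<alpha>] by auto
      have "(f \<alpha> / F) powr u * (g \<alpha> / G) powr v \<le> u * (f \<alpha> / F) + v * (g \<alpha> / G)"
        using pos FG uv by (intro Youngs_inequality_0) auto
      then have "F powr u * G powr v * ((f \<alpha> / F) powr u * (g \<alpha> / G) powr v)
        \<le> F powr u * G powr v * (u * (f \<alpha> / F) + v * (g \<alpha> / G))"
        by (intro mult_left_mono) auto
      moreover have "F powr u * G powr v * ((f \<alpha> / F) powr u * (g \<alpha> / G) powr v) = f \<alpha> powr u * g \<alpha> powr v"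
        using pos FG by (simp add: powr_divide)
      ultimately show ?thesis by simp
    qed
    have "mean N (\<lambda>\<alpha>. f \<alpha> powr u * g \<alpha> powr v)
       \<le> mean N (\<lambda>\<alpha>. F powr u * G powr v * (u * (f \<alpha> / F) + v * (g \<alpha> / G)))"
      by (rule mean_mono) (rule young)
    also have "\<dots> = F powr u * G powr v * (u * (mean N f / F) + v * (mean N g / G))"
      by (simp only: mean_cmult mean_add mean_divide)
    also have "\<dots> = F powr u * G powr v"
      using FG uv by (simp add: F_def G_def)
    finally show ?thesis by (simp add: F_def G_def)
  qed
qed

text \<open>For residue classes modulo \<open>p^a\<close> and \<open>p^b\<close>,
  \<open>mixed X (2 * m) (12 - 2 * m)\<close> is the mean value whose maximum over the classes is
  \<open>I_m(a, b)\<close>.\<close>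

definition mixed :: "nat \<Rightarrow> nat \<Rightarrow> nat \<Rightarrow> int set \<Rightarrow> int set \<Rightarrow> real" where
  "mixed X m n A B =
    mean (modulus X) (\<lambda>\<alpha>. cmod (weyl_sum (modulus X) A \<alpha>) ^ m * cmod (weyl_sum (modulus X) B \<alpha>) ^ n)"

lemma mixed_nonneg [simp]: "0 \<le> mixed X m n A B"
  by (simp add: mixed_def mean_nonneg)

lemma mixed_commute: "mixed X m n A B = mixed X n m B A"
  by (simp add: mixed_def mult.commute)

lemma power_interpolate:
  fixes x u v :: real
  assumes "0 \<le> x" "0 < u" "0 < v" and m: "real m = u * i + v * k"
  shows "(x ^ i) powr u * (x ^ k) powr v = x ^ m"
proof (cases "x = 0")
  \<comment> \<open>At \<open>x = 0\<close> the convention \<open>0 ^ 0 = 1\<close> matters: both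
    sides are 1 if \<open>i\<close> and \<open>k\<close> vanish, and otherwise a factor on the left
    is 0.\<close>
  case True
  show ?thesis
  proof (cases "m = 0")
    case True
    have "u * i \<ge> 0" "v * k \<ge> 0" using assms by auto
    with m True have "u * i = 0" "v * k = 0" by linarith+
    then have "i = 0" "k = 0" using assms by auto
    with True show ?thesis by simp
  next
    case False
    then have "i \<noteq> 0 \<or> k \<noteq> 0" using m by (metis add_0 mult_zero_right of_nat_0 of_nat_eq_iff)
    with False True show ?thesis by (auto simp: power_0_left)
  qed
next
  case False
  with \<open>0 \<le> x\<close> have x: "x > 0" by simp
  have "(x ^ i) powr u * (x ^ k) powr v = x powr (u * i) * x powr (v * k)"
    using x by (simp add: powr_realpow [symmetric] powr_powr mult.commute)
  also have "\<dots> = x ^ m"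
    using x by (simp add: powr_add [symmetric] m [symmetric] powr_realpow)
  finally show ?thesis .
qed

lemma mixed_holder:
  assumes uv: "0 < u" "0 < v" "u + v = 1"
    and m: "real m = u * i + v * k" and n: "real n = u * j + v * l"
  shows "mixed X m n A B \<le> mixed X i j A B powr u * mixed X k l A B powr v"
proof -
  have "mixed X m n A B = mean (modulus X) (\<lambda>\<alpha>.
    (cmod (weyl_sum (modulus X) A \<alpha>) ^ i * cmod (weyl_sum (modulus X) B \<alpha>) ^ j) powr u *
    (cmod (weyl_sum (modulus X) A \<alpha>) ^ k * cmod (weyl_sum (modulus X) B \<alpha>) ^ l) powr v)"
    unfolding mixed_def
    by (intro arg_cong[where f="mean _"] ext)
       (simp add: power_interpolate[OF norm_ge_zero uv(1,2) m, symmetric]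
          power_interpolate[OF norm_ge_zero uv(1,2) n, symmetric] powr_mult)
  also have "\<dots> \<le> mixed X i j A B powr u * mixed X k l A B powr v"
    unfolding mixed_def using uv by (intro mean_holder) auto
  finally show ?thesis .
qed

text \<open>The equations equate sums over the indices \<open>1..6\<close> and \<open>7..12\<close>; the variable with index
  \<open>i + 6\<close> is the partner of the one with index \<open>i\<close>.\<close>

definition split_family :: "nat \<Rightarrow> int set \<Rightarrow> int set \<Rightarrow> nat \<Rightarrow> int set" where
  "split_family m A B i = (if i \<in> {1..m} \<union> {7..6 + m} then A else B)"

text \<open>Congruence arguments act on solutions and Hoelder's inequality on mean values; this
  equality passes from one to the other.\<close>

lemma card_solutions_split:
  assumes "A \<subseteq> {1..int X}" "B \<subseteq> {1..int X}" "m \<le> 6"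
  shows "card (solutions (split_family m A B)) = mixed X (2 * m) (12 - 2 * m) A B"
proof -
  let ?S = "{1..m} \<union> {7..6 + m}"
  have S: "?S \<subseteq> {1..12}" using assms by auto
  have cS: "card ?S = 2 * m" using assms by (subst card_Un_disjoint) auto
  have c: "card ({1..12} - ?S) = 12 - 2 * m"
    using S cS by (subst card_Diff_subset) auto
  have "(\<Prod>i\<in>{1..12}. f (split_family m A B i)) = f A ^ (2 * m) * f B ^ (12 - 2 * m)" for f :: "_ \<Rightarrow> real"
  proof -
    have "(\<Prod>i\<in>{1..12}. f (split_family m A B i)) = (\<Prod>i\<in>{1..12}. if i \<in> ?S then f A else f B)"
      by (intro prod.cong) (auto simp: split_family_def)
    also have "\<dots> = f A ^ card ({1..12} \<inter> ?S) * f B ^ card ({1..12} - ?S)"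
      by (subst prod.If_cases) (simp_all only: finite_atLeastAtMost prod_constant Collect_mem_eq Diff_eq)
    also have "{1..12} \<inter> ?S = ?S" using S by blast
    finally show ?thesis by (simp only: c cS)
  qed
  note eq = this[of "\<lambda>A. cmod (weyl_sum (modulus X) A _)"]
  have "real (card (solutions (split_family m A B))) =
    mean (modulus X) (\<lambda>\<alpha>. \<Prod>i\<in>{1..12}. cmod (weyl_sum (modulus X) (split_family m A B i) \<alpha>))"
    by (rule card_solutions_eq) (use assms in \<open>auto simp: split_family_def\<close>)
  then show ?thesis by (simp only: eq mixed_def)
qed

lemma card_solutions_const:
  assumes "A \<subseteq> {1..int X}" "m + n = 12"
  shows "card (solutions (\<lambda>_. A)) = mixed X m n A A"
proof -
  have "(\<lambda>_. A) = split_family 0 A A" by (simp add: split_family_def fun_eq_iff)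
  then have "card (solutions (\<lambda>_. A)) = mixed X 0 12 A A" using card_solutions_split[of A X A 0] assms by simp
  also have "\<dots> = mixed X m n A A" using assms by (simp add: mixed_def power_add [symmetric])
  finally show ?thesis .
qed

text \<open>The indices 1, 2, 7, 8 are those of the first class in \<open>split_family 2\<close>;
  raising the modulus can put these four variables into four different classes.\<close>

definition quad_family :: "int set \<Rightarrow> int set \<Rightarrow> int set \<Rightarrow> int set \<Rightarrow> int set \<Rightarrow> nat \<Rightarrow> int set" where
  "quad_family A1 A2 A7 A8 B i =
    (if i = 1 then A1 else if i = 2 then A2 else if i = 7 then A7 else if i = 8 then A8 else B)"

text \<open>The arithmetic-geometric mean inequality, with the difference written as an explicit sum
  of squares.\<close>

lemma prod4_le_mean_power4:
  fixes x y z w :: real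
  shows "x * y * z * w \<le> (x ^ 4 + y ^ 4 + z ^ 4 + w ^ 4) / 4"
proof -
  have "(x ^ 4 + y ^ 4 + z ^ 4 + w ^ 4) / 4 - x * y * z * w =
      (x * y - z * w)\<^sup>2 / 2 + ((x\<^sup>2 - y\<^sup>2)\<^sup>2 + (z\<^sup>2 - w\<^sup>2)\<^sup>2) / 4"
    by (simp add: power2_eq_square power4_eq_xxxx field_simps)
  moreover have "0 \<le> \<dots>" by simp
  ultimately show ?thesis by linarith
qed

text \<open>Replacing the product of four different factors by the average of their fourth powers
  leads back to mean values of the form \<open>mixed X 4 8\<close>.\<close>

lemma card_solutions_quad_le:
  fixes K :: real
  assumes sub: "A1 \<subseteq> {1..int X}" "A2 \<subseteq> {1..int X}" "A7 \<subseteq> {1..int X}" "A8 \<subseteq> {1..int X}" "B \<subseteq> {1..int X}"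
    and K: "mixed X 4 8 A1 B \<le> K" "mixed X 4 8 A2 B \<le> K" "mixed X 4 8 A7 B \<le> K" "mixed X 4 8 A8 B \<le> K"
  shows "card (solutions (quad_family A1 A2 A7 A8 B)) \<le> K"
proof -
  let ?w = "\<lambda>A \<alpha>. cmod (weyl_sum (modulus X) A \<alpha>)"
  have I: "{1..12} = {1,2,3,4,5,6,7,8,9,10,11,12::nat}" unfolding set_eq_iff atLeastAtMost_iff insert_iff empty_iff by presburger
  have p: "(\<Prod>i\<in>{1..12}. ?w (quad_family A1 A2 A7 A8 B i) \<alpha>) =
     ?w A1 \<alpha> * ?w A2 \<alpha> * ?w A7 \<alpha> * ?w A8 \<alpha> * ?w B \<alpha> ^ 8" for \<alpha>
    unfolding I by (simp add: quad_family_def eval_nat_numeral mult_ac)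
  have "card (solutions (quad_family A1 A2 A7 A8 B)) \<le>
      mean (modulus X) (\<lambda>\<alpha>. \<Prod>i\<in>{1..12}. ?w (quad_family A1 A2 A7 A8 B i) \<alpha>)"
    by (rule card_solutions_le) (use sub in \<open>auto simp: quad_family_def\<close>)
  also have "\<dots> \<le> mean (modulus X) (\<lambda>\<alpha>.
      (?w A1 \<alpha> ^ 4 * ?w B \<alpha> ^ 8 + ?w A2 \<alpha> ^ 4 * ?w B \<alpha> ^ 8 +
       ?w A7 \<alpha> ^ 4 * ?w B \<alpha> ^ 8 + ?w A8 \<alpha> ^ 4 * ?w B \<alpha> ^ 8) / 4)"
  proof (rule mean_mono)
    fix \<alpha>
    have "?w A1 \<alpha> * ?w A2 \<alpha> * ?w A7 \<alpha> * ?w A8 \<alpha> * ?w B \<alpha> ^ 8 \<le>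
        (?w A1 \<alpha> ^ 4 + ?w A2 \<alpha> ^ 4 + ?w A7 \<alpha> ^ 4 + ?w A8 \<alpha> ^ 4) / 4 * ?w B \<alpha> ^ 8"
      by (intro mult_right_mono prod4_le_mean_power4) auto
    then show "(\<Prod>i\<in>{1..12}. ?w (quad_family A1 A2 A7 A8 B i) \<alpha>) \<le>
       (?w A1 \<alpha> ^ 4 * ?w B \<alpha> ^ 8 + ?w A2 \<alpha> ^ 4 * ?w B \<alpha> ^ 8 +
       ?w A7 \<alpha> ^ 4 * ?w B \<alpha> ^ 8 + ?w A8 \<alpha> ^ 4 * ?w B \<alpha> ^ 8) / 4"
      unfolding p by (simp only: distrib_right times_divide_eq_left)
  qed
  also have "\<dots> = (mixed X 4 8 A1 B + mixed X 4 8 A2 B + mixed X 4 8 A7 B + mixed X 4 8 A8 B) / 4"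
    by (simp only: mixed_def mean_add mean_divide)
  also have "\<dots> \<le> K" using K by simp
  finally show ?thesis .
qed

section \<open>Residue classes and invariance under translation and dilation\<close>

definition residue_class :: "nat \<Rightarrow> int \<Rightarrow> nat \<Rightarrow> int set" where
  "residue_class X c q = {n \<in> {1..int X}. int q dvd n - c}"

lemma residue_class_subset: "residue_class X c q \<subseteq> {1..int X}"
  by (auto simp: residue_class_def)

text \<open>In the binomial expansion the sums of positive degree agree by assumption, and the pure
  powers of \<open>d\<close> cancel because both sides have six variables.\<close>

lemma power_sums_agree_shift:
  assumes "power_sums_agree x"
  shows "power_sums_agree (\<lambda>i. x i - d)"
proof -
  have e: "(\<Sum>i=1..6. x i) = (\<Sum>i=7..12. x i)" "(\<Sum>i=1..6. x i ^ 2) = (\<Sum>i=7..12. x i ^ 2)"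
      "(\<Sum>i=1..6. x i ^ 3) = (\<Sum>i=7..12. x i ^ 3)"
    using assms by (auto simp: power_sums_agree_def dest: bspec[of _ _ 1] bspec[of _ _ 2] bspec[of _ _ 3])
  have three: "{1..3} = {1,2,3::nat}" by auto
  have p2: "(\<Sum>i\<in>I. (x i - d) ^ 2) = (\<Sum>i\<in>I. x i ^ 2) - 2 * d * (\<Sum>i\<in>I. x i) + of_nat (card I) * d ^ 2"
    for I :: "nat set"
    by (simp add: power2_diff sum.distrib sum_subtractf sum_distrib_left sum_distrib_right mult_ac)
  have p3: "(\<Sum>i\<in>I. (x i - d) ^ 3) =
      (\<Sum>i\<in>I. x i ^ 3) - 3 * d * (\<Sum>i\<in>I. x i ^ 2) + 3 * d ^ 2 * (\<Sum>i\<in>I. x i) - of_nat (card I) * d ^ 3"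
    for I :: "nat set"
  proof -
    have "(x i - d) ^ 3 = x i ^ 3 - 3 * d * x i ^ 2 + 3 * d ^ 2 * x i - d ^ 3" for i
      by (simp add: power3_eq_cube power2_eq_square algebra_simps)
    then show ?thesis by (simp add: sum.distrib sum_subtractf sum_distrib_left)
  qed
  show ?thesis
    unfolding power_sums_agree_def three by (simp add: p2 p3 e sum_subtractf del: One_nat_def)
qed

lemma power_sums_agree_dilate:
  assumes "power_sums_agree (\<lambda>i. q * x i)" "q \<noteq> 0"
  shows "power_sums_agree x"
  using assms by (simp add: power_sums_agree_def power_mult_distrib sum_distrib_left [symmetric])

lemma power_sums_agree_cong: "(\<And>i. i \<in> {1..12} \<Longrightarrow> x i = y i) \<Longrightarrow> power_sums_agree x \<longleftrightarrow> power_sums_agree y"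
  unfolding power_sums_agree_def by (intro ball_cong refl arg_cong2[where f="(=)"] sum.cong) auto

lemma finite_solutions: "(\<And>i. i \<in> {1..12} \<Longrightarrow> finite (A i)) \<Longrightarrow> finite (solutions A)"
  unfolding solutions_def by (rule finite_subset[OF _ finite_PiE[of "{1..12}" A]]) auto

lemma solutions_mono: "x \<in> solutions A \<Longrightarrow> (\<And>i. i \<in> {1..12} \<Longrightarrow> x i \<in> B i) \<Longrightarrow> x \<in> solutions B"
  by (auto simp: solutions_def PiE_iff)

lemma solutions_mem: "x \<in> solutions A \<Longrightarrow> i \<in> {1..12} \<Longrightarrow> x i \<in> A i"
  by (auto simp: solutions_def)

text \<open>Subtracting the common residue and dividing by \<open>q\<close> maps the solutions
  injectively to solutions in a shorter interval.\<close>

lemma card_solutions_residue_class_le: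
  assumes q: "q > 0"
  shows "card (solutions (\<lambda>_. residue_class X c q)) \<le> card (solutions (\<lambda>_. {1..int (X div q + 1)}))"
proof (rule card_inj_on_le)
  let ?f = "\<lambda>x. \<lambda>i\<in>{1..12}. x i div int q + (1 :: int)"
  have decomp: "n = int q * (n div int q) + c mod int q" if "n \<in> residue_class X c q" for n
  proof -
    have "n mod int q = c mod int q" using that by (simp add: residue_class_def mod_eq_dvd_iff)
    then show ?thesis by (metis mult_div_mod_eq)
  qed
  show "inj_on ?f (solutions (\<lambda>_. residue_class X c q))"
  proof (rule inj_onI)
    fix x y assume x: "x \<in> solutions (\<lambda>_. residue_class X c q)" and y: "y \<in> solutions (\<lambda>_. residue_class X c q)" and eq: "?f x = ?f y"
    show "x = y"
    proof (rule PiE_ext[of _ "{1..12}" "\<lambda>_. residue_class X c q"])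
      fix i :: nat assume i: "i \<in> {1..12}"
      have "x i div int q = y i div int q" using fun_cong[OF eq, of i] i by simp
      then show "x i = y i"
        using decomp[OF solutions_mem[OF x i]] decomp[OF solutions_mem[OF y i]] by metis
    qed (use x y in \<open>auto simp: solutions_def\<close>)
  qed
  show "?f ` solutions (\<lambda>_. residue_class X c q) \<subseteq> solutions (\<lambda>_. {1..int (X div q + 1)})"
  proof (clarify)
    fix x assume x: "x \<in> solutions (\<lambda>_. residue_class X c q)"
    then have "power_sums_agree x" by (simp add: solutions_def)
    \<comment> \<open>Subtracting \<open>c mod q - q\<close> instead of \<open>c mod q\<close>
      raises the quotients by 1, so that they start at 1; hence the bound
      \<open>X div q + 1\<close>.\<close>
    then have "power_sums_agree (\<lambda>i. x i - (c mod int q - int q))" by (rule power_sums_agree_shift)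
    moreover have "x i - (c mod int q - int q) = int q * ?f x i" if "i \<in> {1..12}" for i
      using decomp[OF solutions_mem[OF x that]] that by (simp add: algebra_simps)
    ultimately have "power_sums_agree (\<lambda>i. int q * ?f x i)"
      using power_sums_agree_cong[of "\<lambda>i. x i - (c mod int q - int q)" "\<lambda>i. int q * ?f x i"] by blast
    then have v: "power_sums_agree (?f x)" by (rule power_sums_agree_dilate) (use q in simp)
    have "x i div int q + 1 \<in> {1..int (X div q + 1)}" if "i \<in> {1..12}" for i
    proof -
      have "1 \<le> x i" "x i \<le> int X" using solutions_mem[OF x that] by (auto simp: residue_class_def)
      then have "0 \<le> x i div int q" "x i div int q \<le> int X div int q"
        using q by (auto simp: pos_imp_zdiv_nonneg_iff intro: zdiv_mono1)
      then show ?thesis by (simp add: zdiv_int)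
    qed
    with v show "?f x \<in> solutions (\<lambda>_. {1..int (X div q + 1)})"
      by (auto simp: solutions_def PiE_iff extensional_def)
  qed
  show "finite (solutions (\<lambda>_. {1..int (X div q + 1)}))" by (rule finite_solutions) auto
qed

section \<open>Raising the modulus\<close>

text \<open>With \<open>n - \<xi> = p^a K\<close>, the number \<open>k\<close> is \<open>K\<close>
  reduced modulo \<open>p^(c - a)\<close>.\<close>

lemma residue_lift:
  fixes n \<xi> :: int and p :: nat
  assumes "int (p ^ a) dvd n - \<xi>" "a \<le> c" "p > 0"
  shows "\<exists>k<p ^ (c - a). int (p ^ c) dvd n - (\<xi> + int (p ^ a) * int k)"
proof -
  obtain K where K: "n - \<xi> = int (p ^ a) * K" using assms(1) by (elim dvdE)
  define k where "k = nat (K mod int (p ^ (c - a)))"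
  have pos: "int (p ^ (c - a)) > 0" using assms by simp
  then have k: "int k = K mod int (p ^ (c - a))" by (simp add: k_def)
  have "int k < int (p ^ (c - a))" unfolding k using pos by (rule pos_mod_bound)
  then have "k < p ^ (c - a)" by (simp only: of_nat_less_iff)
  moreover have "int (p ^ (c - a)) dvd K - int k" unfolding k by (simp add: minus_mod_eq_mult_div)
  then have "int (p ^ a) * int (p ^ (c - a)) dvd int (p ^ a) * (K - int k)" by (rule mult_dvd_mono[OF dvd_refl])
  moreover have "int (p ^ a) * int (p ^ (c - a)) = int (p ^ c)"
    using assms(2) by (simp add: power_add [symmetric] flip: of_nat_mult)
  moreover have "n - (\<xi> + int (p ^ a) * int k) = int (p ^ a) * (K - int k)"
    using K by (simp add: algebra_simps)
  ultimately show ?thesis by metis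
qed

lemma prime_not_dvd_int:
  assumes "prime p" "p \<ge> 5"
  shows "\<not> int p dvd 2" "\<not> int p dvd 3"
  using assms by (auto dest: zdvd_imp_le)

lemma prime_power_dvd_cancel:
  fixes x y :: int
  assumes "prime p" "\<not> int p dvd y" "int (p ^ e) dvd x * y"
  shows "int (p ^ e) dvd x"
proof -
  have "coprime (int p) y" using assms by (intro prime_imp_coprime) auto
  then have "coprime (int (p ^ e)) y" by simp
  with assms(3) show ?thesis by (simp add: coprime_dvd_mult_left_iff)
qed

lemma dvd_of_power_dvd:
  fixes n :: int
  assumes "int (p ^ a) dvd n" "1 \<le> a"
  shows "int p dvd n"
  using assms by (metis dvd_power dvd_trans of_nat_dvd_iff less_eq_Suc_le One_nat_def zero_less_one)

text \<open>The cofactor of \<open>u - v\<close> in \<open>u^3 - v^3\<close> is congruent to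
  \<open>3 t^2\<close> modulo \<open>p\<close>, hence prime to \<open>p\<close>.\<close>

lemma cube_congruence:
  fixes u v t :: int
  assumes p: "prime p" "p \<ge> 5" and t: "\<not> int p dvd t"
    and uv: "int p dvd u - t" "int p dvd v - t"
    and dvd: "int (p ^ e) dvd u ^ 3 - v ^ 3"
  shows "int (p ^ e) dvd u - v"
proof (rule prime_power_dvd_cancel[OF p(1)])
  have "u ^ 3 - v ^ 3 = (u - v) * (u ^ 2 + u * v + v ^ 2)"
    by (simp add: power3_eq_cube power2_eq_square algebra_simps)
  with dvd show "int (p ^ e) dvd (u - v) * (u ^ 2 + u * v + v ^ 2)" by simp
  show "\<not> int p dvd u ^ 2 + u * v + v ^ 2"
  proof
    assume "int p dvd u ^ 2 + u * v + v ^ 2"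
    moreover have "u ^ 2 + u * v + v ^ 2 = (u - t) * (u + t + v) + (v - t) * (v + 2 * t) + 3 * t ^ 2"
      by (simp add: power2_eq_square algebra_simps)
    ultimately have "int p dvd 3 * t ^ 2"
      using uv by (metis dvd_add_right_iff dvd_add dvd_mult2)
    then show False
      using p t prime_not_dvd_int[OF p] by (auto simp: prime_dvd_mult_iff prime_dvd_power_iff)
  qed
qed

text \<open>With \<open>s\<close> and \<open>q\<close> the sums of \<open>u\<^sub>i\<close> and \<open>u\<^sub>i\<^sup>2\<close>, twice the sum of cubes is \<open>s (3 q - s\<^sup>2)\<close>. Comparing
  this for \<open>u\<close> and \<open>v\<close> makes the difference of the linear sums, multiplied by a factor congruent
  to \<open>- 6 t\<^sup>2\<close> modulo \<open>p\<close>, divisible by \<open>p\<^sup>e\<close>.\<close>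

lemma pair_congruence:
  fixes u1 u2 v1 v2 t :: int
  assumes p: "prime p" "p \<ge> 5" and t: "\<not> int p dvd t"
    and uv: "int p dvd u1 - t" "int p dvd u2 - t" "int p dvd v1 - t" "int p dvd v2 - t"
    and d2: "int (p ^ e) dvd u1 ^ 2 + u2 ^ 2 - v1 ^ 2 - v2 ^ 2"
    and d3: "int (p ^ e) dvd u1 ^ 3 + u2 ^ 3 - v1 ^ 3 - v2 ^ 3"
  shows "int (p ^ e) dvd u1 + u2 - v1 - v2" "int (p ^ e) dvd (u1 - v1) * (u1 - v2)"
proof -
  define W where "W = 3 * (u1 ^ 2 + u2 ^ 2) - (u1 + u2) ^ 2 - (u1 + u2) * (v1 + v2) - (v1 + v2) ^ 2"
  have "(u1 + u2 - v1 - v2) * W = 2 * (u1 ^ 3 + u2 ^ 3 - v1 ^ 3 - v2 ^ 3)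
     - 3 * (v1 + v2) * (u1 ^ 2 + u2 ^ 2 - v1 ^ 2 - v2 ^ 2)"
    by (simp add: W_def power3_eq_cube power2_eq_square algebra_simps)
  also have "int (p ^ e) dvd \<dots>" by (rule dvd_diff[OF dvd_mult[OF d3] dvd_mult[OF d2]])
  finally have dW: "int (p ^ e) dvd (u1 + u2 - v1 - v2) * W" .
  show s: "int (p ^ e) dvd u1 + u2 - v1 - v2"
  proof (rule prime_power_dvd_cancel[OF p(1) _ dW])
    show "\<not> int p dvd W"
    proof
      assume "int p dvd W"
      obtain k1 k2 l1 l2 where "u1 - t = int p * k1" "u2 - t = int p * k2" "v1 - t = int p * l1" "v2 - t = int p * l2"
        using uv by (elim dvdE)
      then have "u1 = t + int p * k1" "u2 = t + int p * k2" "v1 = t + int p * l1" "v2 = t + int p * l2"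
        by simp_all
      then have "W = - (2 * 3 * t ^ 2) + int p * (6 * t * (k1 + k2) + 3 * int p * (k1 ^ 2 + k2 ^ 2)
          - 4 * t * (k1 + k2) - int p * (k1 + k2) ^ 2 - 2 * t * (k1 + k2 + l1 + l2) - int p * (k1 + k2) * (l1 + l2)
          - 4 * t * (l1 + l2) - int p * (l1 + l2) ^ 2)"
        by (simp add: W_def power2_eq_square algebra_simps)
      with \<open>int p dvd W\<close> have "int p dvd - (2 * 3 * t ^ 2)"
        by (metis dvd_add_left_iff dvd_triv_left)
      then have "int p dvd 2 * (3 * t ^ 2)" by (simp only: dvd_minus_iff mult.assoc)
      moreover have "prime (int p)" using p by simp
      ultimately show False
        using t prime_not_dvd_int[OF p] by (metis prime_dvd_mult_iff prime_dvd_power)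
    qed
  qed
  \<comment> \<open>Substituting \<open>u2 = v1 + v2 - u1\<close>, allowed by the linear congruence,
    turns the quadratic one into \<open>2 (u1 - v1) (u1 - v2)\<close>.\<close>
  have "(u1 - v1) * (u1 - v2) * 2 = (u1 ^ 2 + u2 ^ 2 - v1 ^ 2 - v2 ^ 2)
     - (u1 + u2 - v1 - v2) * (u2 + v1 + v2 - u1)"
    by (simp add: power2_eq_square algebra_simps)
  also have "int (p ^ e) dvd \<dots>" by (rule dvd_diff[OF d2 dvd_mult2[OF s]])
  finally show "int (p ^ e) dvd (u1 - v1) * (u1 - v2)"
    using prime_power_dvd_cancel[OF p(1) prime_not_dvd_int(1)[OF p]] by blast
qed

text \<open>A divisor of a product is a product of divisors of the factors, and up to sign the
  divisors of \<open>p^n\<close> are powers of \<open>p\<close>.\<close>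

lemma prime_power_dvd_mult_split:
  fixes x y :: int
  assumes p: "prime p" and dvd: "int (p ^ n) dvd x * y"
  shows "\<exists>i\<le>n. int (p ^ i) dvd x \<and> int (p ^ (n - i)) dvd y"
proof -
  obtain b c where bc: "int (p ^ n) = b * c" "b dvd x" "c dvd y"
    using division_decomp[OF dvd] by blast
  have "b dvd int p ^ n" using bc(1) by simp
  then obtain i where i: "i \<le> n" "normalize b = int p ^ i"
    using p divides_primepow[of "int p" b n] by auto
  have "\<bar>b\<bar> * \<bar>c\<bar> = int p ^ n" using bc(1) by (simp add: abs_mult [symmetric] flip: bc(1))
  also have "\<dots> = int p ^ i * int p ^ (n - i)" using i by (simp flip: power_add)
  finally have "\<bar>c\<bar> = int p ^ (n - i)" using i p by (simp add: prime_gt_0_nat)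
  with i bc(2,3) show ?thesis by (metis abs_dvd_iff normalize_int_def of_nat_power)
qed

section \<open>Solutions in residue classes lie in finer classes\<close>

lemma power_sums_agree_dvd_1:
  fixes y :: "nat \<Rightarrow> int"
  assumes "power_sums_agree y" "j \<in> {1..3}" and d: "\<And>i. i \<in> {1..12} - {1, 7} \<Longrightarrow> d dvd y i ^ j"
  shows "d dvd y 1 ^ j - y 7 ^ j"
proof -
  have s: "(\<Sum>i=1..6. y i ^ j) = y 1 ^ j + (\<Sum>i=2..6. y i ^ j)"
     "(\<Sum>i=7..12. y i ^ j) = y 7 ^ j + (\<Sum>i=8..12. y i ^ j)"
    by (simp_all add: sum.atLeast_Suc_atMost eval_nat_numeral)
  have "(\<Sum>i=1..6. y i ^ j) = (\<Sum>i=7..12. y i ^ j)" using assms(1,2) unfolding power_sums_agree_def by blast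
  then have "y 1 ^ j - y 7 ^ j = (\<Sum>i=8..12. y i ^ j) - (\<Sum>i=2..6. y i ^ j)"
    unfolding s by linarith
  also have "d dvd \<dots>" using d by (intro dvd_diff dvd_sum) auto
  finally show ?thesis .
qed

lemma power_sums_agree_dvd_2:
  fixes y :: "nat \<Rightarrow> int"
  assumes "power_sums_agree y" "j \<in> {1..3}" and d: "\<And>i. i \<in> {1..12} - {1, 2, 7, 8} \<Longrightarrow> d dvd y i ^ j"
  shows "d dvd y 1 ^ j + y 2 ^ j - y 7 ^ j - y 8 ^ j"
proof -
  have s: "(\<Sum>i=1..6. y i ^ j) = y 1 ^ j + y 2 ^ j + (\<Sum>i=3..6. y i ^ j)"
     "(\<Sum>i=7..12. y i ^ j) = y 7 ^ j + y 8 ^ j + (\<Sum>i=9..12. y i ^ j)"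
    by (simp_all add: sum.atLeast_Suc_atMost eval_nat_numeral)
  have "(\<Sum>i=1..6. y i ^ j) = (\<Sum>i=7..12. y i ^ j)" using assms(1,2) unfolding power_sums_agree_def by blast
  then have "y 1 ^ j + y 2 ^ j - y 7 ^ j - y 8 ^ j = (\<Sum>i=9..12. y i ^ j) - (\<Sum>i=3..6. y i ^ j)"
    unfolding s by linarith
  also have "d dvd \<dots>" using d by (intro dvd_diff dvd_sum) auto
  finally show ?thesis .
qed

text \<open>After translating by \<open>\<eta>\<close>, all variables except 1 and 7 are divisible
  by \<open>p^b\<close>. The cubic equation then gives a congruence modulo \<open>p^(3b)\<close>
  between the cubes of these two, and hence between the two themselves, so they share one of the
  \<open>p^(3b - a)\<close> finer classes.\<close>

lemma solutions_refine_1: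
  assumes p: "prime p" "p \<ge> 5" and ab: "1 \<le> a" "a \<le> 3 * b" "1 \<le> b" and t: "\<not> int p dvd \<xi> - \<eta>"
  shows "solutions (split_family 1 (residue_class X \<xi> (p ^ a)) (residue_class X \<eta> (p ^ b))) \<subseteq>
    (\<Union>k<p ^ (3 * b - a). solutions (split_family 1 (residue_class X (\<xi> + int (p ^ a) * int k) (p ^ (3 * b))) (residue_class X \<eta> (p ^ b))))"
proof
  fix x assume x: "x \<in> solutions (split_family 1 (residue_class X \<xi> (p ^ a)) (residue_class X \<eta> (p ^ b)))"
  note mem = solutions_mem[OF x]
  have x17: "x 1 \<in> residue_class X \<xi> (p ^ a)" "x 7 \<in> residue_class X \<xi> (p ^ a)" using mem[of 1] mem[of 7] by (auto simp: split_family_def)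
  have xr: "x i \<in> residue_class X \<eta> (p ^ b)" if "i \<in> {1..12} - {1, 7}" for i using mem[of i] that by (auto simp: split_family_def)
  define y where "y = (\<lambda>i. x i - \<eta>)"
  have vy: "power_sums_agree y" using x power_sums_agree_shift[of x \<eta>] by (simp add: solutions_def y_def)
  have dy: "int (p ^ (3 * b)) dvd y i ^ 3" if i: "i \<in> {1..12} - {1, 7}" for i
  proof -
    have "int (p ^ b) dvd y i" using xr[OF i] by (simp add: residue_class_def y_def)
    then have "int (p ^ b) ^ 3 dvd y i ^ 3" by (rule dvd_power_same)
    then show ?thesis by (simp add: power_mult [symmetric] mult.commute)
  qed
  have d3: "int (p ^ (3 * b)) dvd y 1 ^ 3 - y 7 ^ 3" by (rule power_sums_agree_dvd_1[OF vy _ dy]) auto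
  have y17: "int p dvd y 1 - (\<xi> - \<eta>)" "int p dvd y 7 - (\<xi> - \<eta>)"
    using x17 ab by (auto simp: residue_class_def y_def intro: dvd_of_power_dvd)
  have "int (p ^ (3 * b)) dvd y 1 - y 7" by (rule cube_congruence[OF p t y17 d3])
  then have d: "int (p ^ (3 * b)) dvd x 1 - x 7" by (simp add: y_def)
  obtain k where k: "k < p ^ (3 * b - a)" "int (p ^ (3 * b)) dvd x 1 - (\<xi> + int (p ^ a) * int k)"
    using residue_lift[of p a "x 1" \<xi> "3 * b"] x17 ab p by (auto simp: residue_class_def)
  have "int (p ^ (3 * b)) dvd x 7 - (\<xi> + int (p ^ a) * int k)"
    using dvd_diff[OF k(2) d] by (simp add: algebra_simps)
  with k have "x 1 \<in> residue_class X (\<xi> + int (p ^ a) * int k) (p ^ (3 * b))"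
      "x 7 \<in> residue_class X (\<xi> + int (p ^ a) * int k) (p ^ (3 * b))"
    using x17 by (auto simp: residue_class_def)
  with xr have "x \<in> solutions (split_family 1 (residue_class X (\<xi> + int (p ^ a) * int k) (p ^ (3 * b))) (residue_class X \<eta> (p ^ b)))"
    by (intro solutions_mono[OF x]) (auto simp: split_family_def)
  with k show "x \<in> (\<Union>k<p ^ (3 * b - a). solutions (split_family 1 (residue_class X (\<xi> + int (p ^ a) * int k) (p ^ (3 * b))) (residue_class X \<eta> (p ^ b))))"
    by blast
qed

lemma not_dvd_center:
  assumes "\<not> int p dvd \<xi> - \<eta>" "1 \<le> a"
  shows "\<not> int p dvd \<xi> + int (p ^ a) * k - \<eta>"
proof -
  have "int p dvd int (p ^ a) * k" using assms(2) by (intro dvd_mult2) (auto simp: dvd_power)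
  then show ?thesis using assms(1) by (metis add_diff_eq add.commute dvd_add_right_iff)
qed

lemma mixed_refine_1:
  assumes p: "prime p" "p \<ge> 5" and ab: "1 \<le> a" "a \<le> 3 * b" "1 \<le> b" and t: "\<not> int p dvd \<xi> - \<eta>"
    and K: "\<And>c. \<not> int p dvd c - \<eta> \<Longrightarrow> mixed X 2 10 (residue_class X c (p ^ (3 * b))) (residue_class X \<eta> (p ^ b)) \<le> K"
  shows "mixed X 2 10 (residue_class X \<xi> (p ^ a)) (residue_class X \<eta> (p ^ b)) \<le> real p ^ (3 * b - a) * K"
proof -
  let ?S = "\<lambda>k. solutions (split_family 1 (residue_class X (\<xi> + int (p ^ a) * int k) (p ^ (3 * b))) (residue_class X \<eta> (p ^ b)))"
  have eq: "real (card (solutions (split_family 1 (residue_class X c q) (residue_class X d r)))) = mixed X 2 10 (residue_class X c q) (residue_class X d r)" for c d q r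
    using card_solutions_split[of "residue_class X c q" X "residue_class X d r" 1] by (simp add: residue_class_subset)
  have fin: "finite (residue_class X c q)" for c q using residue_class_subset by (rule finite_subset) simp
  have "card (solutions (split_family 1 (residue_class X \<xi> (p ^ a)) (residue_class X \<eta> (p ^ b)))) \<le> card (\<Union>k<p ^ (3 * b - a). ?S k)"
    by (rule card_mono[OF _ solutions_refine_1[OF p ab t]])
       (auto intro!: finite_solutions simp: split_family_def fin)
  also have "\<dots> \<le> (\<Sum>k<p ^ (3 * b - a). card (?S k))" by (rule card_UN_le) simp
  finally have "mixed X 2 10 (residue_class X \<xi> (p ^ a)) (residue_class X \<eta> (p ^ b)) \<le> (\<Sum>k<p ^ (3 * b - a). real (card (?S k)))"
    unfolding eq [symmetric] by (simp only: of_nat_sum [symmetric] of_nat_le_iff)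
  also have "\<dots> \<le> (\<Sum>k<p ^ (3 * b - a). K)"
    unfolding eq by (intro sum_mono K not_dvd_center t ab)
  finally show ?thesis by simp
qed

text \<open>Writing the variables \<open>1, 7, 8\<close> as \<open>\<xi> + p\<^sup>a Z\<close>, \<open>\<xi> + p\<^sup>a W\<^sub>1\<close>, \<open>\<xi> + p\<^sup>a W\<^sub>2\<close>, the product
  \<open>(Z - W\<^sub>1) (Z - W\<^sub>2)\<close> is divisible by \<open>p\<^sup>n\<close>, hence the factors by some \<open>p\<^sup>i\<close> and \<open>p\<^sup>n\<^sup>-\<^sup>i\<close>. The union is
  over \<open>i\<close>, the residue \<open>z\<close> of \<open>Z\<close> and the residues \<open>k, l\<close> of the two quotients; variable \<open>2\<close> is then
  determined by the linear congruence.\<close>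

lemma solutions_refine_2:
  fixes p a b X :: nat and \<xi> \<eta> :: int
  defines "n \<equiv> 2 * b - 2 * a"
  defines "center \<equiv> (\<lambda>z :: int. \<xi> + int (p ^ a) * z)"
  defines "fam \<equiv> (\<lambda>i z k l. quad_family (residue_class X (center (int z)) (p ^ (2 * b - a)))
        (residue_class X (center (int z - int (p ^ i) * int k - int (p ^ (n - i)) * int l)) (p ^ (2 * b - a)))
        (residue_class X (center (int z - int (p ^ i) * int k)) (p ^ (2 * b - a)))
        (residue_class X (center (int z - int (p ^ (n - i)) * int l)) (p ^ (2 * b - a)))
        (residue_class X \<eta> (p ^ b)))"
  assumes p: "prime p" "p \<ge> 5" and ab: "1 \<le> a" "a \<le> b" and t: "\<not> int p dvd \<xi> - \<eta>"
  shows "solutions (split_family 2 (residue_class X \<xi> (p ^ a)) (residue_class X \<eta> (p ^ b))) \<subseteq>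
    (\<Union>i\<in>{..n}. \<Union>z\<in>{..<p ^ n}. \<Union>k\<in>{..<p ^ (n - i)}. \<Union>l\<in>{..<p ^ i}. solutions (fam i z k l))"
proof
  fix x assume x: "x \<in> solutions (split_family 2 (residue_class X \<xi> (p ^ a)) (residue_class X \<eta> (p ^ b)))"
  note mem = solutions_mem[OF x]
  have xs: "x 1 \<in> residue_class X \<xi> (p ^ a)" "x 2 \<in> residue_class X \<xi> (p ^ a)" "x 7 \<in> residue_class X \<xi> (p ^ a)" "x 8 \<in> residue_class X \<xi> (p ^ a)"
    using mem[of 1] mem[of 2] mem[of 7] mem[of 8] by (auto simp: split_family_def)
  have xr: "x i \<in> residue_class X \<eta> (p ^ b)" if "i \<in> {1..12} - {1, 2, 7, 8}" for i
    using mem[of i] that by (auto simp: split_family_def split: if_splits)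
  have p0: "p > 0" using p by simp
  define y where "y = (\<lambda>i. x i - \<eta>)"
  have vy: "power_sums_agree y" using x power_sums_agree_shift[of x \<eta>] by (simp add: solutions_def y_def)
  \<comment> \<open>Squares and cubes are divisible by \<open>p^(2b)\<close>, first powers only by
    \<open>p^b\<close>; the linear congruence modulo \<open>p^(2b)\<close> therefore has to come
    from \<open>pair_congruence\<close>.\<close>
  have dj: "int (p ^ (2 * b)) dvd y i ^ j" if i: "i \<in> {1..12} - {1, 2, 7, 8}" and j: "j \<in> {2, 3}" for i j
  proof -
    have "int (p ^ b) dvd y i" using xr[OF i] by (simp add: residue_class_def y_def)
    then have "int (p ^ b) ^ 2 dvd y i ^ 2" by (rule dvd_power_same)
    also have "y i ^ 2 dvd y i ^ j" using j by (intro le_imp_power_dvd) auto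
    finally show ?thesis by (simp add: power_mult [symmetric] mult.commute)
  qed
  have d2: "int (p ^ (2 * b)) dvd y 1 ^ 2 + y 2 ^ 2 - y 7 ^ 2 - y 8 ^ 2"
    by (rule power_sums_agree_dvd_2[OF vy]) (auto intro: dj simp del: of_nat_power)
  have d3: "int (p ^ (2 * b)) dvd y 1 ^ 3 + y 2 ^ 3 - y 7 ^ 3 - y 8 ^ 3"
    by (rule power_sums_agree_dvd_2[OF vy]) (auto intro: dj simp del: of_nat_power)
  have ys: "int p dvd y i - (\<xi> - \<eta>)" if "i \<in> {1, 2, 7, 8}" for i
    using xs ab that by (auto simp: residue_class_def y_def intro: dvd_of_power_dvd)
  have "int (p ^ (2 * b)) dvd y 1 + y 2 - y 7 - y 8" "int (p ^ (2 * b)) dvd (y 1 - y 7) * (y 1 - y 8)"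
    using pair_congruence[OF p t ys ys ys ys d2 d3] by auto
  then have lin: "int (p ^ (2 * b)) dvd x 1 + x 2 - x 7 - x 8"
    and quadr: "int (p ^ (2 * b)) dvd (x 1 - x 7) * (x 1 - x 8)" by (simp_all add: y_def algebra_simps)
  obtain Z W1 W2 where Z: "x 1 - \<xi> = int (p ^ a) * Z" "x 7 - \<xi> = int (p ^ a) * W1" "x 8 - \<xi> = int (p ^ a) * W2"
    using xs unfolding residue_class_def by (auto elim!: dvdE)
  have "(x 1 - x 7) * (x 1 - x 8) = int (p ^ (2 * a)) * ((Z - W1) * (Z - W2))"
  proof -
    have "x 1 - x 7 = int (p ^ a) * (Z - W1)" "x 1 - x 8 = int (p ^ a) * (Z - W2)"
      using Z by (simp_all add: algebra_simps)
    then show ?thesis by (simp add: mult_2 power_add)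
  qed
  moreover have "int (p ^ (2 * b)) = int (p ^ (2 * a)) * int (p ^ n)"
    using ab by (simp add: n_def power_add [symmetric] flip: of_nat_mult)
  ultimately have "int (p ^ n) dvd (Z - W1) * (Z - W2)" using quadr p0 by simp
  then obtain i where i: "i \<le> n" "int (p ^ i) dvd Z - W1" "int (p ^ (n - i)) dvd Z - W2"
    using prime_power_dvd_mult_split[OF p(1)] by blast
  obtain z where z: "z < p ^ n" "int (p ^ n) dvd Z - int z"
    using residue_lift[of p 0 Z 0 n] p0 by auto
  obtain k where k: "k < p ^ (n - i)" "int (p ^ n) dvd Z - W1 - int (p ^ i) * int k"
    using residue_lift[of p i "Z - W1" 0 n] p0 i by auto
  obtain l where l: "l < p ^ i" "int (p ^ n) dvd Z - W2 - int (p ^ (n - i)) * int l"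
    using residue_lift[of p "n - i" "Z - W2" 0 n] p0 i by auto
  \<comment> \<open>Cancelling \<open>p^(2a)\<close> left congruences modulo \<open>p^n\<close> for
    \<open>Z\<close>, \<open>W1\<close>, \<open>W2\<close>; multiplying by \<open>p^a\<close> gives
    modulus \<open>p^(2b - a)\<close> for the variables.\<close>
  have q: "p ^ (2 * b - a) = p ^ a * p ^ n" using ab by (simp add: n_def flip: power_add)
  have up: "int (p ^ (2 * b - a)) dvd int (p ^ a) * r" if "int (p ^ n) dvd r" for r
    unfolding q of_nat_mult using that by (intro mult_dvd_mono dvd_refl)
  have c1: "int (p ^ (2 * b - a)) dvd x 1 - center (int z)"
  proof -
    have "x 1 - center (int z) = int (p ^ a) * (Z - int z)"
      using Z by (simp add: center_def algebra_simps)
    with up[OF z(2)] show ?thesis by simp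
  qed
  have c7: "int (p ^ (2 * b - a)) dvd x 7 - center (int z - int (p ^ i) * int k)"
  proof -
    have "x 7 - center (int z - int (p ^ i) * int k) = int (p ^ a) * ((Z - int z) - (Z - W1 - int (p ^ i) * int k))"
      using Z by (simp add: center_def algebra_simps)
    with up[OF dvd_diff[OF z(2) k(2)]] show ?thesis by simp
  qed
  have c8: "int (p ^ (2 * b - a)) dvd x 8 - center (int z - int (p ^ (n - i)) * int l)"
  proof -
    have "x 8 - center (int z - int (p ^ (n - i)) * int l) = int (p ^ a) * ((Z - int z) - (Z - W2 - int (p ^ (n - i)) * int l))"
      using Z by (simp add: center_def algebra_simps)
    with up[OF dvd_diff[OF z(2) l(2)]] show ?thesis by simp
  qed
  have c2: "int (p ^ (2 * b - a)) dvd x 2 - center (int z - int (p ^ i) * int k - int (p ^ (n - i)) * int l)"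
  proof -
    have "int (p ^ (2 * b - a)) dvd int (p ^ (2 * b))" unfolding of_nat_dvd_iff by (intro le_imp_power_dvd) simp
    then have "int (p ^ (2 * b - a)) dvd x 1 + x 2 - x 7 - x 8" using lin by (rule dvd_trans)
    from dvd_add[OF dvd_diff[OF this c1] dvd_add[OF c7 c8]]
    show ?thesis by (simp add: center_def algebra_simps)
  qed
  have "x \<in> solutions (fam i z k l)"
  proof (rule solutions_mono[OF x])
    fix j :: nat assume "j \<in> {1..12}"
    then show "x j \<in> fam i z k l j"
      using xs xr[of j] c1 c2 c7 c8 unfolding fam_def quad_family_def by (auto simp: residue_class_def)
  qed
  with i z k l show "x \<in> (\<Union>i\<in>{..n}. \<Union>z\<in>{..<p ^ n}. \<Union>k\<in>{..<p ^ (n - i)}. \<Union>l\<in>{..<p ^ i}. solutions (fam i z k l))"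
    unfolding UN_iff lessThan_iff atMost_iff by blast
qed

lemma mixed_refine_2:
  assumes p: "prime p" "p \<ge> 5" and ab: "1 \<le> a" "a \<le> b" and t: "\<not> int p dvd \<xi> - \<eta>"
    and K: "\<And>c. \<not> int p dvd c - \<eta> \<Longrightarrow> mixed X 4 8 (residue_class X c (p ^ (2 * b - a))) (residue_class X \<eta> (p ^ b)) \<le> K"
  shows "mixed X 4 8 (residue_class X \<xi> (p ^ a)) (residue_class X \<eta> (p ^ b)) \<le> 2 * real b * real p ^ (4 * (b - a)) * K"
proof -
  define n where "n = 2 * b - 2 * a"
  define center where "center = (\<lambda>z :: int. \<xi> + int (p ^ a) * z)"
  define S where "S = (\<lambda>i z k l. solutions (quad_family (residue_class X (center (int z)) (p ^ (2 * b - a)))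
        (residue_class X (center (int z - int (p ^ i) * int k - int (p ^ (n - i)) * int l)) (p ^ (2 * b - a)))
        (residue_class X (center (int z - int (p ^ i) * int k)) (p ^ (2 * b - a)))
        (residue_class X (center (int z - int (p ^ (n - i)) * int l)) (p ^ (2 * b - a)))
        (residue_class X \<eta> (p ^ b))))"
  have eq: "real (card (solutions (split_family 2 (residue_class X c q) (residue_class X d r)))) = mixed X 4 8 (residue_class X c q) (residue_class X d r)" for c d q r
    using card_solutions_split[of "residue_class X c q" X "residue_class X d r" 2] by (simp add: residue_class_subset)
  have fin: "finite (residue_class X c q)" for c q using residue_class_subset by (rule finite_subset) simp
  have finS: "finite (S i z k l)" for i z k l
    unfolding S_def by (rule finite_solutions) (simp add: quad_family_def fin)
  have SK: "real (card (S i z k l)) \<le> K" for i z k l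
    unfolding S_def center_def
    by (intro card_solutions_quad_le[where X = X] residue_class_subset K not_dvd_center t ab)
  have K0: "0 \<le> K" using SK[of 0 0 0 0] by (rule order.trans[OF of_nat_0_le_iff])
  have sub: "solutions (split_family 2 (residue_class X \<xi> (p ^ a)) (residue_class X \<eta> (p ^ b))) \<subseteq>
    (\<Union>i\<in>{..n}. \<Union>z\<in>{..<p ^ n}. \<Union>k\<in>{..<p ^ (n - i)}. \<Union>l\<in>{..<p ^ i}. S i z k l)"
    unfolding S_def center_def n_def by (rule solutions_refine_2[OF p ab t])
  have "card (solutions (split_family 2 (residue_class X \<xi> (p ^ a)) (residue_class X \<eta> (p ^ b)))) \<le>
     card (\<Union>i\<in>{..n}. \<Union>z\<in>{..<p ^ n}. \<Union>k\<in>{..<p ^ (n - i)}. \<Union>l\<in>{..<p ^ i}. S i z k l)"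
    by (rule card_mono[OF _ sub]) (auto simp: finS)
  also have "\<dots> \<le> (\<Sum>i\<in>{..n}. \<Sum>z\<in>{..<p ^ n}. \<Sum>k\<in>{..<p ^ (n - i)}. \<Sum>l\<in>{..<p ^ i}. card (S i z k l))"
    by (intro order.trans[OF card_UN_le] sum_mono order.refl) auto
  finally have "mixed X 4 8 (residue_class X \<xi> (p ^ a)) (residue_class X \<eta> (p ^ b)) \<le>
     real (\<Sum>i\<in>{..n}. \<Sum>z\<in>{..<p ^ n}. \<Sum>k\<in>{..<p ^ (n - i)}. \<Sum>l\<in>{..<p ^ i}. card (S i z k l))"
    unfolding eq [symmetric] of_nat_le_iff .
  also have "\<dots> \<le> (\<Sum>i\<in>{..n}. \<Sum>z\<in>{..<p ^ n}. \<Sum>k\<in>{..<p ^ (n - i)}. \<Sum>l\<in>{..<p ^ i}. K)"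
    unfolding of_nat_sum by (intro sum_mono SK)
  \<comment> \<open>For each \<open>i\<close> there are \<open>p^n p^(n - i) p^i = p^(2n)\<close>
    choices of \<open>z\<close>, \<open>k\<close>, \<open>l\<close>, independently of
    \<open>i\<close>.\<close>
  also have "\<dots> = (\<Sum>i\<in>{..n}. real p ^ (2 * n) * K)"
    by (intro sum.cong refl) (simp add: mult_2 power_add [symmetric] flip: mult.assoc)
  also have "\<dots> = real (n + 1) * real p ^ (2 * n) * K" by simp
  \<comment> \<open>Here \<open>n + 1 = 2 (b - a) + 1\<close>, which is at most \<open>2 b\<close>
    since \<open>a \<ge> 1\<close>.\<close>
  also have "\<dots> \<le> 2 * real b * real p ^ (2 * n) * K"
    using K0 ab by (intro mult_right_mono) (auto simp: n_def of_nat_diff)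
  also have "2 * n = 4 * (b - a)" using ab by (simp add: n_def)
  finally show ?thesis by simp
qed

section \<open>The recursion and the main induction\<close>

definition mean_value :: "nat \<Rightarrow> real" where
  "mean_value K = card (solutions (\<lambda>_. {1..int K}))"

lemma mixed_residue_class_le:
  assumes "m + n = 12" "q > 0"
  shows "mixed X m n (residue_class X c q) (residue_class X c q) \<le> mean_value (X div q + 1)"
  using card_solutions_const[OF residue_class_subset[of X c q] assms(1)] card_solutions_residue_class_le[OF assms(2), of X c]
  by (simp add: mean_value_def)

lemma mixed_12_0: "mixed X 12 0 A B = mixed X 12 0 A A"
  by (simp add: mixed_def)

lemma mixed_0_12: "mixed X 0 12 A B = mixed X 0 12 B B"
  by (simp add: mixed_def)

text \<open>First \<open>p^a\<close> is raised to \<open>p^(2b - a)\<close>. Hoelder's inequality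
  with (4, 8) = 1/3 (8, 4) + 2/3 (2, 10) leaves a factor with exponents (2, 10), in which the
  modulus rises further to \<open>p^(3b)\<close>; then (2, 10) = 1/4 (8, 4) + 3/4 (0, 12).
  Exchanging the two classes turns (8, 4) into (4, 8), with \<open>p^b\<close> in the role of
  \<open>p^a\<close>.\<close>

lemma mixed_recursion:
  assumes p: "prime p" "p \<ge> 5" and ab: "1 \<le> a" "a \<le> b" and t: "\<not> int p dvd \<xi> - \<eta>"
    and K1: "\<And>c. \<not> int p dvd c - \<eta> \<Longrightarrow> mixed X 4 8 (residue_class X \<eta> (p ^ b)) (residue_class X c (p ^ (2 * b - a))) \<le> K1"
    and K2: "\<And>c. \<not> int p dvd c - \<eta> \<Longrightarrow> mixed X 4 8 (residue_class X \<eta> (p ^ b)) (residue_class X c (p ^ (3 * b))) \<le> K2"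
    and K3: "mean_value (X div p ^ b + 1) \<le> K3"
  shows "mixed X 4 8 (residue_class X \<xi> (p ^ a)) (residue_class X \<eta> (p ^ b)) \<le>
    2 * real b * real p ^ (4 * (b - a)) *
      (K1 powr (1/3) * (real p ^ (a + b) * (K2 powr (1/4) * K3 powr (3/4))) powr (2/3))"
proof (rule mixed_refine_2[OF p ab t])
  fix c assume c: "\<not> int p dvd c - \<eta>"
  have p0: "p > 0" using p by simp
  have "mixed X 2 10 (residue_class X c (p ^ (2 * b - a))) (residue_class X \<eta> (p ^ b)) \<le>
     real p ^ (3 * b - (2 * b - a)) * (K2 powr (1/4) * K3 powr (3/4))"
  proof (rule mixed_refine_1[OF p _ _ _ c])
    fix d assume d: "\<not> int p dvd d - \<eta>"
    have "mixed X 2 10 (residue_class X d (p ^ (3 * b))) (residue_class X \<eta> (p ^ b)) \<le>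
      mixed X 8 4 (residue_class X d (p ^ (3 * b))) (residue_class X \<eta> (p ^ b)) powr (1/4) *
      mixed X 0 12 (residue_class X d (p ^ (3 * b))) (residue_class X \<eta> (p ^ b)) powr (3/4)"
      by (rule mixed_holder) simp_all
    also have "\<dots> \<le> K2 powr (1/4) * K3 powr (3/4)"
    proof (intro mult_mono powr_mono2)
      show "mixed X 8 4 (residue_class X d (p ^ (3 * b))) (residue_class X \<eta> (p ^ b)) \<le> K2"
        using K2[OF d] by (subst mixed_commute)
      show "mixed X 0 12 (residue_class X d (p ^ (3 * b))) (residue_class X \<eta> (p ^ b)) \<le> K3"
        using mixed_residue_class_le[of 0 12 "p ^ b" X \<eta>] K3 p0 by (subst mixed_0_12) simp
    qed auto
    finally show "mixed X 2 10 (residue_class X d (p ^ (3 * b))) (residue_class X \<eta> (p ^ b)) \<le> K2 powr (1/4) * K3 powr (3/4)" .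
  qed (use ab in auto)
  moreover have "3 * b - (2 * b - a) = a + b" using ab by simp
  ultimately have I1: "mixed X 2 10 (residue_class X c (p ^ (2 * b - a))) (residue_class X \<eta> (p ^ b)) \<le>
     real p ^ (a + b) * (K2 powr (1/4) * K3 powr (3/4))" by simp
  have "mixed X 4 8 (residue_class X c (p ^ (2 * b - a))) (residue_class X \<eta> (p ^ b)) \<le>
     mixed X 8 4 (residue_class X c (p ^ (2 * b - a))) (residue_class X \<eta> (p ^ b)) powr (1/3) *
     mixed X 2 10 (residue_class X c (p ^ (2 * b - a))) (residue_class X \<eta> (p ^ b)) powr (2/3)"
    by (rule mixed_holder) simp_all
  also have "\<dots> \<le> K1 powr (1/3) * (real p ^ (a + b) * (K2 powr (1/4) * K3 powr (3/4))) powr (2/3)"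
  proof (intro mult_mono powr_mono2 I1)
    show "mixed X 8 4 (residue_class X c (p ^ (2 * b - a))) (residue_class X \<eta> (p ^ b)) \<le> K1"
      using K1[OF c] by (subst mixed_commute)
  qed auto
  finally show "mixed X 4 8 (residue_class X c (p ^ (2 * b - a))) (residue_class X \<eta> (p ^ b)) \<le>
     K1 powr (1/3) * (real p ^ (a + b) * (K2 powr (1/4) * K3 powr (3/4))) powr (2/3)" .
qed

lemma mean_value_quotient_le:
  fixes E C :: real
  assumes q: "q \<ge> 2" "q \<le> X" and X: "X \<ge> 3" and E: "E \<ge> 0" and C: "C > 0"
    and IH: "\<And>Y. 1 \<le> Y \<Longrightarrow> Y < X \<Longrightarrow> mean_value Y \<le> C * real Y powr E"
  shows "mean_value (X div q + 1) \<le> 2 powr E * (C * X powr E) * real q powr (- E)"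
proof -
  \<comment> \<open>For \<open>q \<ge> 2\<close> and \<open>X \<ge> 3\<close> the new length is
    below \<open>X\<close>, so the hypothesis applies; it is at most \<open>2 X / q\<close> because
    \<open>q \<le> X\<close>, whence the factor \<open>2 powr E\<close>.\<close>
  have "X div q \<le> X div 2" using q by (intro div_le_mono2) auto
  then have "X div q + 1 < X" using X by linarith
  then have "mean_value (X div q + 1) \<le> C * real (X div q + 1) powr E" by (intro IH) auto
  also have "\<dots> \<le> C * (2 * (X / q)) powr E"
  proof (intro mult_left_mono powr_mono2)
    have "real (X div q * q) \<le> real X" by (simp only: of_nat_le_iff div_times_less_eq_dividend)
    then have "real (X div q) \<le> X / q" using q by (simp add: field_simps)
    moreover have "1 \<le> X / q" using q by simp
    ultimately show "real (X div q + 1) \<le> 2 * (X / q)" by simp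
  qed (use E C in auto)
  also have "\<dots> = 2 powr E * (C * X powr E) * real q powr (- E)"
    using q by (simp add: powr_mult powr_divide powr_minus_divide)
  finally show ?thesis .
qed

text \<open>The exponent \<open>- 2 a - 4 b\<close> comes from the trivial bound. It is reproduced by the recursion,
  which gains a factor \<open>p\<^sup>-\<^sup>\<epsilon>\<^sup>b\<^sup>/\<^sup>2\<close>, and \<open>b / 2 \<ge> (3 b - a) / 6\<close>. The weight \<open>3 b - a\<close> is itself
  reproduced by the recursion. It is essential that \<open>K\<close> does not depend on \<open>p\<close>, as \<open>p\<close> is chosen
  after it.\<close>

lemma mixed_decay:
  fixes \<epsilon> :: real
  assumes \<epsilon>: "\<epsilon> > 0"
  shows "1 \<le> a \<Longrightarrow> a \<le> b \<Longrightarrow> \<exists>K>0. \<forall>p X C \<xi> \<eta>. prime p \<longrightarrow> p \<ge> 5 \<longrightarrow> p ^ (3 ^ n * b) \<le> X \<longrightarrow> C > 0 \<longrightarrow>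
    (\<forall>Y. 1 \<le> Y \<longrightarrow> Y < X \<longrightarrow> mean_value Y \<le> C * real Y powr (6 + \<epsilon>)) \<longrightarrow> \<not> int p dvd \<xi> - \<eta> \<longrightarrow>
    mixed X 4 8 (residue_class X \<xi> (p ^ a)) (residue_class X \<eta> (p ^ b)) \<le>
      K * (C * X powr (6 + \<epsilon>)) * real p powr (- 2 * real a - 4 * real b - real n * \<epsilon> / 6 * (3 * real b - real a))"
proof (induction n arbitrary: a b)
  case 0
  show ?case
  proof (intro exI[of _ "2 powr (6 + \<epsilon>)"] conjI allI impI)
    fix p X :: nat and C :: real and \<xi> \<eta> :: int
    assume p: "prime p" "p \<ge> 5" and pX: "p ^ (3 ^ 0 * b) \<le> X" and C: "C > 0"
      and IH: "\<forall>Y. 1 \<le> Y \<longrightarrow> Y < X \<longrightarrow> mean_value Y \<le> C * real Y powr (6 + \<epsilon>)"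
    define D where "D = C * X powr (6 + \<epsilon>)"
    have ge5: "p ^ c \<ge> 5" if "1 \<le> c" for c using p(2) self_le_power[of p c] that by simp
    have X: "X \<ge> 5" using ge5[of b] pX 0 by simp
    have D: "D > 0" using C X by (simp add: D_def)
    have bnd: "mean_value (X div p ^ c + 1) \<le> 2 powr (6 + \<epsilon>) * D * real p powr (- (c * (6 + \<epsilon>)))"
      if c: "1 \<le> c" "c \<le> b" for c
    proof -
      have "p ^ c \<le> p ^ b" using c p by (intro power_increasing) auto
      then have "mean_value (X div p ^ c + 1) \<le> 2 powr (6 + \<epsilon>) * (C * X powr (6 + \<epsilon>)) * real (p ^ c) powr (- (6 + \<epsilon>))"
        using ge5[OF c(1)] X pX IH C \<epsilon> by (intro mean_value_quotient_le) auto
      also have "real (p ^ c) powr (- (6 + \<epsilon>)) = real p powr (- (c * (6 + \<epsilon>)))"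
        using p by (simp add: powr_realpow [symmetric] powr_powr prime_gt_0_nat algebra_simps)
      finally show ?thesis by (simp only: D_def)
    qed
    have p0: "p > 0" using p by simp
    \<comment> \<open>The trivial bound: (4, 8) = 1/3 (12, 0) + 2/3 (0, 12), and each pure mean
      value counts solutions in a single class.\<close>
    have "mixed X 4 8 (residue_class X \<xi> (p ^ a)) (residue_class X \<eta> (p ^ b)) \<le>
        mixed X 12 0 (residue_class X \<xi> (p ^ a)) (residue_class X \<eta> (p ^ b)) powr (1/3) *
        mixed X 0 12 (residue_class X \<xi> (p ^ a)) (residue_class X \<eta> (p ^ b)) powr (2/3)"
      by (rule mixed_holder) simp_all
    also have "\<dots> \<le> (2 powr (6 + \<epsilon>) * D * real p powr (- (a * (6 + \<epsilon>)))) powr (1/3) *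
        (2 powr (6 + \<epsilon>) * D * real p powr (- (b * (6 + \<epsilon>)))) powr (2/3)"
    proof (intro mult_mono powr_mono2)
      show "mixed X 12 0 (residue_class X \<xi> (p ^ a)) (residue_class X \<eta> (p ^ b)) \<le> 2 powr (6 + \<epsilon>) * D * real p powr (- (a * (6 + \<epsilon>)))"
        using mixed_residue_class_le[of 12 0 "p ^ a" X \<xi>] bnd[of a] p0 0 by (subst mixed_12_0) simp
      show "mixed X 0 12 (residue_class X \<xi> (p ^ a)) (residue_class X \<eta> (p ^ b)) \<le> 2 powr (6 + \<epsilon>) * D * real p powr (- (b * (6 + \<epsilon>)))"
        using mixed_residue_class_le[of 0 12 "p ^ b" X \<eta>] bnd[of b] p0 0 by (subst mixed_0_12) simp
    qed auto
    also have "\<dots> = ((2 powr (6 + \<epsilon>) * D) powr (1/3) * (2 powr (6 + \<epsilon>) * D) powr (2/3)) *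
        (real p powr (- (a * (6 + \<epsilon>)) * (1/3)) * real p powr (- (b * (6 + \<epsilon>)) * (2/3)))"
      using D by (simp only: powr_mult powr_powr mult_ac)
    also have "\<dots> = 2 powr (6 + \<epsilon>) * D * real p powr (- (a * (6 + \<epsilon>)) * (1/3) + - (b * (6 + \<epsilon>)) * (2/3))"
      using D by (simp only: powr_add [symmetric]) simp
    also have "\<dots> \<le> 2 powr (6 + \<epsilon>) * D * real p powr (- 2 * real a - 4 * real b - 0 * \<epsilon> / 6 * (3 * real b - real a))"
    proof (intro mult_left_mono powr_mono)
      have "0 \<le> \<epsilon> * real a" "0 \<le> \<epsilon> * real b" using \<epsilon> by auto
      then show "- (a * (6 + \<epsilon>)) * (1/3) + - (b * (6 + \<epsilon>)) * (2/3) \<le> - 2 * real a - 4 * real b - 0 * \<epsilon> / 6 * (3 * real b - real a)"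
        by (simp add: algebra_simps)
    qed (use p D in auto)
    finally show "mixed X 4 8 (residue_class X \<xi> (p ^ a)) (residue_class X \<eta> (p ^ b)) \<le>
        2 powr (6 + \<epsilon>) * (C * X powr (6 + \<epsilon>)) * real p powr (- 2 * real a - 4 * real b - real 0 * \<epsilon> / 6 * (3 * real b - real a))"
      by (simp add: D_def)
  qed simp
next
  case (Suc n)
  define g where "g = (\<lambda>n a b :: nat. - 2 * real a - 4 * real b - real n * \<epsilon> / 6 * (3 * real b - real a) :: real)"
  have pre: "1 \<le> b" "b \<le> 2 * b - a" "b \<le> 3 * b" using Suc.prems by auto
  obtain K1 where K1: "K1 > 0" "\<And>p X C \<xi> \<eta>. prime p \<Longrightarrow> p \<ge> 5 \<Longrightarrow> p ^ (3 ^ n * (2 * b - a)) \<le> X \<Longrightarrow> C > 0 \<Longrightarrow>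
    (\<forall>Y. 1 \<le> Y \<longrightarrow> Y < X \<longrightarrow> mean_value Y \<le> C * real Y powr (6 + \<epsilon>)) \<Longrightarrow> \<not> int p dvd \<xi> - \<eta> \<Longrightarrow>
    mixed X 4 8 (residue_class X \<xi> (p ^ b)) (residue_class X \<eta> (p ^ (2 * b - a))) \<le>
      K1 * (C * X powr (6 + \<epsilon>)) * real p powr (g n b (2 * b - a))"
    unfolding g_def using Suc.IH[OF pre(1,2)] by blast
  obtain K2 where K2: "K2 > 0" "\<And>p X C \<xi> \<eta>. prime p \<Longrightarrow> p \<ge> 5 \<Longrightarrow> p ^ (3 ^ n * (3 * b)) \<le> X \<Longrightarrow> C > 0 \<Longrightarrow>
    (\<forall>Y. 1 \<le> Y \<longrightarrow> Y < X \<longrightarrow> mean_value Y \<le> C * real Y powr (6 + \<epsilon>)) \<Longrightarrow> \<not> int p dvd \<xi> - \<eta> \<Longrightarrow>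
    mixed X 4 8 (residue_class X \<xi> (p ^ b)) (residue_class X \<eta> (p ^ (3 * b))) \<le>
      K2 * (C * X powr (6 + \<epsilon>)) * real p powr (g n b (3 * b))"
    unfolding g_def using Suc.IH[OF pre(1,3)] by blast
  \<comment> \<open>The recursion takes \<open>K1\<close> to the power 1/3, \<open>K2\<close> to 1/4
    * 2/3 and the constant from \<open>mean_value_quotient_le\<close> to 3/4 * 2/3.\<close>
  define K where "K = 2 * real b * (K1 powr (1/3) * K2 powr (1/6) * (2 powr (6 + \<epsilon>)) powr (1/2))"
  show ?case
  proof (intro exI[of _ K] conjI allI impI)
    show "K > 0" using K1(1) K2(1) Suc.prems by (simp add: K_def)
    fix p X :: nat and C :: real and \<xi> \<eta> :: int
    assume p: "prime p" "p \<ge> 5" and pX: "p ^ (3 ^ Suc n * b) \<le> X" and C: "C > 0"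
      and IH: "\<forall>Y. 1 \<le> Y \<longrightarrow> Y < X \<longrightarrow> mean_value Y \<le> C * real Y powr (6 + \<epsilon>)" and t: "\<not> int p dvd \<xi> - \<eta>"
    define D where "D = C * X powr (6 + \<epsilon>)"
    define P where "P = real p"
    have P: "P > 1" using p by (simp add: P_def)
    have le: "p ^ e \<le> X" if "e \<le> 3 ^ Suc n * b" for e
      by (rule order.trans[OF power_increasing[OF that] pX]) (use p in simp)
    have ge5: "p ^ b \<ge> 5" using p(2) self_le_power[of p b] Suc.prems by simp
    have pb: "p ^ b \<le> X" by (rule le) simp
    have X: "X \<ge> 5" using ge5 pb by simp
    have D: "D > 0" using C X by (simp add: D_def)
    have b1: "mixed X 4 8 (residue_class X \<eta> (p ^ b)) (residue_class X c (p ^ (2 * b - a))) \<le> K1 * D * P powr (g n b (2 * b - a))"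
      if "\<not> int p dvd c - \<eta>" for c
      unfolding D_def P_def
    proof (rule K1(2)[OF p _ C IH])
      \<comment> \<open>One iteration replaces \<open>b\<close> by at most \<open>3 * b\<close>,
        which the additional factor 3 in the size condition on \<open>X\<close> pays for.\<close>
      have "3 ^ n * (2 * b - a) \<le> 3 ^ n * (3 * b)" by (intro mult_left_mono) auto
      then show "p ^ (3 ^ n * (2 * b - a)) \<le> X" by (intro le) (simp add: mult_ac)
      show "\<not> int p dvd \<eta> - c" using that by (simp add: dvd_diff_commute)
    qed
    have b2: "mixed X 4 8 (residue_class X \<eta> (p ^ b)) (residue_class X c (p ^ (3 * b))) \<le> K2 * D * P powr (g n b (3 * b))"
      if "\<not> int p dvd c - \<eta>" for c
      unfolding D_def P_def
    proof (rule K2(2)[OF p _ C IH])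
      show "p ^ (3 ^ n * (3 * b)) \<le> X" by (intro le) (simp add: mult_ac)
      show "\<not> int p dvd \<eta> - c" using that by (simp add: dvd_diff_commute)
    qed
    have b3: "mean_value (X div p ^ b + 1) \<le> 2 powr (6 + \<epsilon>) * D * P powr (- (b * (6 + \<epsilon>)))"
    proof -
      have "mean_value (X div p ^ b + 1) \<le> 2 powr (6 + \<epsilon>) * (C * X powr (6 + \<epsilon>)) * real (p ^ b) powr (- (6 + \<epsilon>))"
        using ge5 X pb IH C \<epsilon> by (intro mean_value_quotient_le) auto
      also have "real (p ^ b) powr (- (6 + \<epsilon>)) = P powr (- (b * (6 + \<epsilon>)))"
        using P by (simp add: powr_realpow [symmetric] powr_powr P_def algebra_simps)
      finally show ?thesis by (simp only: D_def)
    qed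
    define x1 x2 x3 where x: "x1 = g n b (2 * b - a)" "x2 = g n b (3 * b)" "x3 = - (b * (6 + \<epsilon>))"
    have "mixed X 4 8 (residue_class X \<xi> (p ^ a)) (residue_class X \<eta> (p ^ b)) \<le> 2 * real b * P ^ (4 * (b - a)) *
       ((K1 * D * P powr x1) powr (1/3) *
        (P ^ (a + b) * ((K2 * D * P powr x2) powr (1/4) *
           (2 powr (6 + \<epsilon>) * D * P powr x3) powr (3/4))) powr (2/3))"
      unfolding x P_def by (rule mixed_recursion[OF p Suc.prems t b1 b2 b3, unfolded P_def])
    also have "\<dots> = K * (D powr (1/3) * D powr (1/6) * D powr (1/2)) *
        (P powr (4 * (real b - a)) * P powr (x1 / 3) * P powr ((real a + b) * (2/3)) * P powr (x2 / 6) * P powr (x3 / 2))"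
    proof -
      have e1: "P ^ (4 * (b - a)) = P powr (4 * (real b - a))"
        using P Suc.prems by (simp add: powr_realpow [symmetric] of_nat_diff)
      have e2: "P ^ (a + b) = P powr (real a + b)"
        using P by (simp add: powr_realpow [symmetric])
      show ?thesis
        unfolding e1 e2 K_def
        by (simp add: powr_mult powr_powr mult_ac add_divide_distrib)
    qed
    also have "D powr (1/3) * D powr (1/6) * D powr (1/2) = D"
      using D by (simp add: powr_add [symmetric])
    also have "P powr (4 * (real b - a)) * P powr (x1 / 3) * P powr ((real a + b) * (2/3)) * P powr (x2 / 6) * P powr (x3 / 2)
       = P powr (4 * (real b - a) + x1 / 3 + (real a + b) * (2/3) + x2 / 6 + x3 / 2)"
      by (simp only: powr_add)
    also have "K * D * \<dots> \<le> K * D * P powr (g (Suc n) a b)"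
    proof (intro mult_left_mono powr_mono)
      \<comment> \<open>The weights \<open>5 b - 3 a\<close> and \<open>8 b\<close> of the two
        inductive bounds enter with factors 1/3 and 1/6 and add up to \<open>3 b - a\<close>. The
        new gain of \<open>\<epsilon> b / 2\<close> is half of the excess in
        \<open>x3\<close>.\<close>
      have "4 * (real b - a) + x1 / 3 + (real a + b) * (2/3) + x2 / 6 + x3 / 2
         = g n a b - \<epsilon> / 2 * b"
        using Suc.prems by (simp add: x g_def of_nat_diff field_simps)
      also have "\<dots> \<le> g n a b - \<epsilon> / 6 * (3 * real b - real a)"
        using \<epsilon> by (simp add: algebra_simps)
      also have "\<dots> = g (Suc n) a b" by (simp add: g_def field_simps)
      finally show "4 * (real b - a) + x1 / 3 + (real a + b) * (2/3) + x2 / 6 + x3 / 2 \<le> g (Suc n) a b" .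
    qed (use P D \<open>K > 0\<close> in auto)
    finally show "mixed X 4 8 (residue_class X \<xi> (p ^ a)) (residue_class X \<eta> (p ^ b)) \<le> K * (C * X powr (6 + \<epsilon>)) *
        real p powr (- 2 * real a - 4 * real b - real (Suc n) * \<epsilon> / 6 * (3 * real b - real a))"
      by (simp only: D_def P_def g_def)
  qed
qed

section \<open>From classes modulo a prime to the full mean value\<close>

lemma ex_maximal:
  fixes f :: "'a \<Rightarrow> real"
  assumes "finite I" "I \<noteq> {}"
  obtains c where "c \<in> I" "\<And>i. i \<in> I \<Longrightarrow> f i \<le> f c"
proof -
  have "Max (f ` I) \<in> f ` I" using assms by (intro Max_in) auto
  then obtain c where "c \<in> I" "Max (f ` I) = f c" by auto
  with that[of c] show thesis using assms Max_ge[of "f ` I"] by auto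
qed

text \<open>Let \<open>f c\<close> be the largest term. If it is at least the sum \<open>R\<close>
  of the others, the whole sum is at most \<open>2 * f c\<close>. Otherwise it is at most
  \<open>2 * card I * f d\<close> with \<open>f d\<close> the second largest, and
  \<open>f d ^ 12 \<le> f c ^ 4 * f d ^ 8\<close>. The diagonal constant is free of
  \<open>card I\<close>: the factor \<open>p^11\<close> of Hoelder's inequality would outweigh the
  saving on the diagonal.\<close>

lemma sum_power_12_le:
  fixes f :: "'a \<Rightarrow> real"
  assumes I: "finite I" and f: "\<And>i. i \<in> I \<Longrightarrow> 0 \<le> f i"
  shows "(\<Sum>i\<in>I. f i) ^ 12 \<le> 2 ^ 12 * (\<Sum>i\<in>I. f i ^ 12) +
    (2 * real (card I)) ^ 12 * (\<Sum>c\<in>I. \<Sum>d\<in>I - {c}. f c ^ 4 * f d ^ 8)"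
proof (cases "I = {}")
  case False
  obtain c where c: "c \<in> I" "\<And>i. i \<in> I \<Longrightarrow> f i \<le> f c"
    using ex_maximal[OF I False, of f] by blast
  define R where "R = (\<Sum>i\<in>I - {c}. f i)"
  have S: "(\<Sum>i\<in>I. f i) = f c + R" using I c by (simp add: R_def sum.remove)
  have n1: "0 \<le> (\<Sum>i\<in>I. f i ^ 12)" using f by (intro sum_nonneg) auto
  have n2: "0 \<le> (\<Sum>c\<in>I. \<Sum>d\<in>I - {c}. f c ^ 4 * f d ^ 8)" using f by (intro sum_nonneg) auto
  have R0: "0 \<le> R" unfolding R_def using f by (intro sum_nonneg) auto
  show ?thesis
  proof (cases "R \<le> f c")
    case True
    have "(\<Sum>i\<in>I. f i) ^ 12 \<le> (2 * f c) ^ 12"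
      unfolding S using True R0 f[OF c(1)] by (intro power_mono) auto
    also have "\<dots> = 2 ^ 12 * f c ^ 12" by (simp add: power_mult_distrib)
    also have "f c ^ 12 \<le> (\<Sum>i\<in>I. f i ^ 12)" using I c f by (intro member_le_sum) auto
    finally show ?thesis using n2 by (simp add: add_increasing2)
  next
    case R: False
    then have ne: "I - {c} \<noteq> {}" using f[OF c(1)] by (metis R_def sum.empty)
    obtain d where d: "d \<in> I - {c}" "\<And>i. i \<in> I - {c} \<Longrightarrow> f i \<le> f d"
      using ex_maximal[OF finite_Diff[OF I] ne, of f] by blast
    have fd: "0 \<le> f d" using d f by auto
    have "R \<le> real (card (I - {c})) * f d"
      unfolding R_def using d by (intro sum_bounded_above) auto
    also have "\<dots> \<le> real (card I) * f d"
      using I fd by (intro mult_right_mono) (auto intro: card_mono)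
    finally have "(\<Sum>i\<in>I. f i) ^ 12 \<le> (2 * real (card I) * f d) ^ 12"
      unfolding S using R R0 f[OF c(1)] by (intro power_mono) auto
    also have "\<dots> = (2 * real (card I)) ^ 12 * (f d ^ 4 * f d ^ 8)"
      by (simp add: power_mult_distrib power_add [symmetric])
    also have "f d ^ 4 * f d ^ 8 \<le> f c ^ 4 * f d ^ 8"
      using c d fd by (intro mult_right_mono power_mono) auto
    also have "\<dots> \<le> (\<Sum>d\<in>I - {c}. f c ^ 4 * f d ^ 8)"
      using I d f c by (intro member_le_sum[of d _ "\<lambda>d. f c ^ 4 * f d ^ 8"]) auto
    also have "\<dots> \<le> (\<Sum>c\<in>I. \<Sum>d\<in>I - {c}. f c ^ 4 * f d ^ 8)"
      using I c f by (intro member_le_sum[of c _ "\<lambda>c. \<Sum>d\<in>I - {c}. f c ^ 4 * f d ^ 8"] sum_nonneg) auto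
    finally show ?thesis using n1 by (simp add: add_increasing mult_left_mono)
  qed
qed simp

lemma weyl_sum_classes:
  assumes "p > 0"
  shows "weyl_sum N {1..int X} \<alpha> = (\<Sum>c<p. weyl_sum N (residue_class X (int c) p) \<alpha>)"
proof -
  have "{x \<in> {1..int X}. nat (x mod int p) = c} = residue_class X (int c) p" if "c < p" for c
  proof -
    have "nat (x mod int p) = c \<longleftrightarrow> int p dvd x - int c" for x
    proof -
      have "nat (x mod int p) = c \<longleftrightarrow> x mod int p = int c"
        using assms pos_mod_sign[of "int p" x] by linarith
      also have "\<dots> \<longleftrightarrow> x mod int p = int c mod int p" using that by simp
      finally show ?thesis by (simp add: mod_eq_dvd_iff)
    qed
    then show ?thesis by (simp add: residue_class_def)
  qed
  moreover have "nat (x mod int p) < p" for x using assms by (simp add: nat_less_iff)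
  ultimately show ?thesis
    unfolding weyl_sum_def
    by (subst sum.group[where S = "{1..int X}" and T = "{..<p}" and g = "\<lambda>x. nat (x mod int p)", symmetric])
       auto
qed

lemma mean_value_le_classes:
  assumes p: "p > 0"
  shows "mean_value X \<le> 2 ^ 12 * (\<Sum>c<p. mixed X 12 0 (residue_class X (int c) p) (residue_class X (int c) p)) +
    (2 * real p) ^ 12 * (\<Sum>c<p. \<Sum>d\<in>{..<p} - {c}. mixed X 4 8 (residue_class X (int c) p) (residue_class X (int d) p))"
proof -
  let ?w = "\<lambda>A \<alpha>. cmod (weyl_sum (modulus X) A \<alpha>)"
  let ?c = "\<lambda>c. residue_class X (int c) p"
  have "mean_value X = mixed X 12 0 {1..int X} {1..int X}" unfolding mean_value_def by (rule card_solutions_const) auto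
  also have "\<dots> = mean (modulus X) (\<lambda>\<alpha>. ?w {1..int X} \<alpha> ^ 12)" by (simp add: mixed_def)
  also have "\<dots> \<le> mean (modulus X) (\<lambda>\<alpha>. 2 ^ 12 * (\<Sum>c<p. ?w (?c c) \<alpha> ^ 12) +
     (2 * real p) ^ 12 * (\<Sum>c<p. \<Sum>d\<in>{..<p} - {c}. ?w (?c c) \<alpha> ^ 4 * ?w (?c d) \<alpha> ^ 8))"
  proof (rule mean_mono)
    fix \<alpha>
    have "?w {1..int X} \<alpha> ^ 12 \<le> (\<Sum>c<p. ?w (?c c) \<alpha>) ^ 12"
      unfolding weyl_sum_classes[OF p] by (intro power_mono norm_sum) auto
    also have "\<dots> \<le> 2 ^ 12 * (\<Sum>c<p. ?w (?c c) \<alpha> ^ 12) +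
     (2 * real p) ^ 12 * (\<Sum>c<p. \<Sum>d\<in>{..<p} - {c}. ?w (?c c) \<alpha> ^ 4 * ?w (?c d) \<alpha> ^ 8)"
      using sum_power_12_le[of "{..<p}" "\<lambda>c. ?w (?c c) \<alpha>"] by simp
    finally show "?w {1..int X} \<alpha> ^ 12 \<le> 2 ^ 12 * (\<Sum>c<p. ?w (?c c) \<alpha> ^ 12) +
     (2 * real p) ^ 12 * (\<Sum>c<p. \<Sum>d\<in>{..<p} - {c}. ?w (?c c) \<alpha> ^ 4 * ?w (?c d) \<alpha> ^ 8)" .
  qed
  also have "\<dots> = 2 ^ 12 * (\<Sum>c<p. mixed X 12 0 (residue_class X (int c) p) (residue_class X (int c) p)) +
    (2 * real p) ^ 12 * (\<Sum>c<p. \<Sum>d\<in>{..<p} - {c}. mixed X 4 8 (residue_class X (int c) p) (residue_class X (int d) p))"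
    by (simp only: mean_add mean_cmult mean_sum mixed_def power_0 mult_1_right)
  finally show ?thesis by simp
qed

lemma mean_value_bound:
  fixes \<epsilon> :: real
  assumes \<epsilon>: "\<epsilon> > 0"
  shows "\<exists>C>0. \<forall>X\<ge>1. mean_value X \<le> C * real X powr (6 + \<epsilon>)"
proof -
  \<comment> \<open>After \<open>n\<close> iterations from \<open>a = b = 1\<close> the gain in the
    exponent is \<open>n \<epsilon> / 3 \<ge> 9\<close>, which brings the trivial exponent -6 down
    to -15.\<close>
  define n where "n = nat \<lceil>27 / \<epsilon>\<rceil>"
  have n: "9 \<le> n * \<epsilon> / 3"
  proof -
    have "27 / \<epsilon> \<le> n" unfolding n_def by (rule real_nat_ceiling_ge)
    then show ?thesis using \<epsilon> by (simp add: field_simps)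
  qed
  obtain K where K: "K > 0" "\<And>p X C \<xi> \<eta>. prime p \<Longrightarrow> p \<ge> 5 \<Longrightarrow> p ^ (3 ^ n * 1) \<le> X \<Longrightarrow> C > 0 \<Longrightarrow>
    (\<forall>Y. 1 \<le> Y \<longrightarrow> Y < X \<longrightarrow> mean_value Y \<le> C * real Y powr (6 + \<epsilon>)) \<Longrightarrow> \<not> int p dvd \<xi> - \<eta> \<Longrightarrow>
    mixed X 4 8 (residue_class X \<xi> (p ^ 1)) (residue_class X \<eta> (p ^ 1)) \<le>
      K * (C * X powr (6 + \<epsilon>)) * real p powr (- 2 * real 1 - 4 * real 1 - real n * \<epsilon> / 6 * (3 * real 1 - real 1))"
    using mixed_decay[OF \<epsilon>, of 1 1 n] by blast
  \<comment> \<open>The lower bound exceeds all constants of the final estimate, including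
    \<open>K\<close>, which is fixed before \<open>p\<close>.\<close>
  obtain p where p: "prime p" "p > nat \<lceil>2 ^ 12 * (2 powr (6 + \<epsilon>) + 2 ^ 12 * K) + 5\<rceil>"
    using bigger_prime by blast
  have pK: "2 ^ 12 * (2 powr (6 + \<epsilon>) + 2 ^ 12 * K) + 5 \<le> real p"
    using p(2) by linarith
  then have "5 \<le> real p" using K(1) by (smt (verit) powr_ge_zero zero_less_power mult_nonneg_nonneg)
  then have p5: "p \<ge> 5" by simp
  have p0: "p > 0" using p5 by simp
  \<comment> \<open>The sum settles every \<open>X\<close> below \<open>p ^ 3 ^ n\<close>, where
    \<open>mixed_decay\<close> does not apply; the induction step must then reproduce
    \<open>C\<close> without loss.\<close>
  define C where "C = 1 + (\<Sum>Y<p ^ 3 ^ n. mean_value Y)"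
  have J0: "0 \<le> mean_value Y" for Y by (simp add: mean_value_def)
  have C: "C > 0" using J0 by (simp add: C_def add_pos_nonneg sum_nonneg)
  have "1 \<le> X \<longrightarrow> mean_value X \<le> C * real X powr (6 + \<epsilon>)" for X
  proof (induction X rule: less_induct)
    case (less X)
    show ?case
    proof
      assume X1: "1 \<le> X"
      show "mean_value X \<le> C * real X powr (6 + \<epsilon>)"
      proof (cases "X < p ^ 3 ^ n")
        case True
        then have "mean_value X \<le> (\<Sum>Y<p ^ 3 ^ n. mean_value Y)" using J0 by (intro member_le_sum) auto
        also have "\<dots> \<le> C * 1" by (simp add: C_def)
        also have "\<dots> \<le> C * real X powr (6 + \<epsilon>)"
          using C X1 \<epsilon> by (intro mult_left_mono ge_one_powr_ge_zero) auto
        finally show ?thesis .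
      next
        case False
        then have pX: "p ^ (3 ^ n * 1) \<le> X" by simp
        have "p \<le> p ^ 3 ^ n" using p0 by (intro self_le_power) auto
        then have pleX: "p \<le> X" using pX by simp
        define D where "D = C * real X powr (6 + \<epsilon>)"
        have D: "D > 0" using C X1 by (simp add: D_def)
        have d1: "mixed X 12 0 (residue_class X (int c) p) (residue_class X (int c) p) \<le> 2 powr (6 + \<epsilon>) * D * real p powr (- 6)" for c
        proof -
          have "mixed X 12 0 (residue_class X (int c) p) (residue_class X (int c) p) \<le> mean_value (X div p + 1)"
            using p0 by (intro mixed_residue_class_le) auto
          also have "\<dots> \<le> 2 powr (6 + \<epsilon>) * D * real p powr (- (6 + \<epsilon>))"
            unfolding D_def using p5 pleX \<epsilon> C less by (intro mean_value_quotient_le) auto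
          also have "\<dots> \<le> 2 powr (6 + \<epsilon>) * D * real p powr (- 6)"
            using p0 D \<epsilon> by (intro mult_left_mono powr_mono) auto
          finally show ?thesis .
        qed
        have d2: "mixed X 4 8 (residue_class X (int c) p) (residue_class X (int d) p) \<le> K * D * real p powr (- 15)"
          if "c < p" "d < p" "c \<noteq> d" for c d
        proof -
          have "\<not> int p dvd int c - int d"
            using that by (auto simp flip: mod_eq_dvd_iff)
          then have "mixed X 4 8 (residue_class X (int c) p) (residue_class X (int d) p) \<le>
             K * D * real p powr (- 2 * real 1 - 4 * real 1 - real n * \<epsilon> / 6 * (3 * real 1 - real 1))"
            using K(2)[OF p(1) p5 pX C, of "int c" "int d"] less by (simp add: D_def)
          also have "\<dots> \<le> K * D * real p powr (- 15)"
            using p0 D K(1) n by (intro mult_left_mono powr_mono) (auto simp: mult.commute)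
          finally show ?thesis .
        qed
        have "mean_value X \<le> 2 ^ 12 * (\<Sum>c<p. mixed X 12 0 (residue_class X (int c) p) (residue_class X (int c) p)) +
          (2 * real p) ^ 12 * (\<Sum>c<p. \<Sum>d\<in>{..<p} - {c}. mixed X 4 8 (residue_class X (int c) p) (residue_class X (int d) p))"
          by (rule mean_value_le_classes[OF p0])
        also have "\<dots> \<le> 2 ^ 12 * (\<Sum>c<p. 2 powr (6 + \<epsilon>) * D * real p powr (- 6)) +
          (2 * real p) ^ 12 * (\<Sum>c<p. \<Sum>d<p. K * D * real p powr (- 15))"
        proof (intro add_mono mult_left_mono sum_mono d1)
          fix c assume c: "c \<in> {..<p}"
          have "(\<Sum>d\<in>{..<p} - {c}. mixed X 4 8 (residue_class X (int c) p) (residue_class X (int d) p)) \<le>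
             (\<Sum>d\<in>{..<p} - {c}. K * D * real p powr (- 15))"
            using c by (intro sum_mono d2) auto
          also have "\<dots> \<le> (\<Sum>d<p. K * D * real p powr (- 15))"
            using K(1) D by (intro sum_mono2) auto
          finally show "(\<Sum>d\<in>{..<p} - {c}. mixed X 4 8 (residue_class X (int c) p) (residue_class X (int d) p)) \<le> \<dots>" .
        qed auto
        \<comment> \<open>The diagonal has \<open>p\<close> terms of size \<open>p^(-6)\<close>; off
          it, \<open>p^2\<close> terms of size \<open>p^(-15)\<close> meet the factor
          \<open>(2 p)^12\<close>, leaving \<open>p^(-1)\<close>.\<close>
        also have "\<dots> = D * (2 ^ 12 * 2 powr (6 + \<epsilon>) / p ^ 5 + 2 ^ 12 * K / p)"
          using p0 by (simp add: powr_minus powr_numeral field_simps power_mult_distrib eval_nat_numeral)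
        also have "\<dots> \<le> D * (2 ^ 12 * 2 powr (6 + \<epsilon>) / p + 2 ^ 12 * K / p)"
          using p0 D p5 self_le_power[of "real p" 5]
          by (intro mult_left_mono add_right_mono divide_left_mono) auto
        also have "\<dots> = D * ((2 ^ 12 * 2 powr (6 + \<epsilon>) + 2 ^ 12 * K) / p)"
          by (simp add: add_divide_distrib)
        also have "\<dots> \<le> D * 1"
          using p0 D pK K(1) by (intro mult_left_mono) (auto simp: divide_le_eq)
        finally show ?thesis by (simp add: D_def)
      qed
    qed
  qed
  with C show ?thesis by blast
qed

text \<open>Casting the entries to integers is injective on tuples, and the restriction to
  \<open>{1..12}\<close> keeps the image extensional.\<close>

lemma vinogradov_J_le_mean_value: "real (vinogradov_J 6 3 X) \<le> mean_value (nat \<lfloor>X\<rfloor>)"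
proof -
  let ?f = "\<lambda>x. \<lambda>i\<in>{1..12}. int (x i)"
  have V: "vinogradov_solutions 6 3 X = {x \<in> {1..12} \<rightarrow>\<^sub>E {n. 1 \<le> n \<and> real n \<le> X}.
      \<forall>j\<in>{1..3}. (\<Sum>i = 1..6. x i ^ j) = (\<Sum>i = 7..12. x i ^ j)}"
    by (simp add: vinogradov_solutions_def)
  have "card (vinogradov_solutions 6 3 X) \<le> card (solutions (\<lambda>_. {1..int (nat \<lfloor>X\<rfloor>)}))"
  proof (rule card_inj_on_le[of ?f])
    show "inj_on ?f (vinogradov_solutions 6 3 X)"
    proof (rule inj_onI)
      fix x y assume x: "x \<in> vinogradov_solutions 6 3 X" and y: "y \<in> vinogradov_solutions 6 3 X" and eq: "?f x = ?f y"
      show "x = y"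
      proof (rule PiE_ext[of _ "{1..12}" "\<lambda>_. {n. 1 \<le> n \<and> real n \<le> X}"])
        fix i :: nat assume "i \<in> {1..12}"
        then show "x i = y i" using fun_cong[OF eq, of i] by simp
      qed (use x y in \<open>auto simp: V\<close>)
    qed
    show "?f ` vinogradov_solutions 6 3 X \<subseteq> solutions (\<lambda>_. {1..int (nat \<lfloor>X\<rfloor>)})"
    proof clarify
      fix x assume x: "x \<in> vinogradov_solutions 6 3 X"
      have "power_sums_agree (\<lambda>i. int (x i))"
        using x by (auto simp: V power_sums_agree_def simp flip: of_nat_power of_nat_sum)
      then have "power_sums_agree (?f x)" using power_sums_agree_cong[of "?f x" "\<lambda>i. int (x i)"] by simp
      moreover have "x i \<le> nat \<lfloor>X\<rfloor>" "1 \<le> x i" if "i \<in> {1..12}" for i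
        using x that by (auto simp: V PiE_iff le_nat_floor)
      ultimately show "?f x \<in> solutions (\<lambda>_. {1..int (nat \<lfloor>X\<rfloor>)})"
        by (auto simp: solutions_def simp del: of_nat_nat int_nat_eq)
    qed
  qed (auto intro: finite_solutions)
  then show ?thesis by (simp add: vinogradov_J_def mean_value_def)
qed

theorem theorem1:
  shows "\<forall>\<epsilon>::real. \<epsilon> > 0 \<longrightarrow>
    (\<exists>C::real. \<forall>X::real. X \<ge> 1 \<longrightarrow> real (vinogradov_J 6 3 X) \<le> C * X powr (6 + \<epsilon>))"
proof (intro allI impI)
  fix \<epsilon> :: real assume \<epsilon>: "\<epsilon> > 0"
  then obtain C where C: "C > 0" "\<And>X. X \<ge> 1 \<Longrightarrow> mean_value X \<le> C * real X powr (6 + \<epsilon>)"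
    using mean_value_bound by blast
  have "real (vinogradov_J 6 3 X) \<le> C * X powr (6 + \<epsilon>)" if X: "X \<ge> 1" for X
  proof -
    have "real (vinogradov_J 6 3 X) \<le> mean_value (nat \<lfloor>X\<rfloor>)" by (rule vinogradov_J_le_mean_value)
    also have "\<dots> \<le> C * real (nat \<lfloor>X\<rfloor>) powr (6 + \<epsilon>)"
      using X by (intro C(2)) (simp add: le_nat_floor)
    also have "\<dots> \<le> C * X powr (6 + \<epsilon>)"
      using X C(1) \<epsilon> by (intro mult_left_mono powr_mono2) auto
    finally show ?thesis .
  qed
  then show "\<exists>C::real. \<forall>X::real. X \<ge> 1 \<longrightarrow> real (vinogradov_J 6 3 X) \<le> C * X powr (6 + \<epsilon>)" by blast
qed

end
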